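(* As $t\to\infty$, $$\frac{u(t,Z^{(1)}_t)+u(t,-Z^{(1)}_t)}{U(t)}\to 1\qquad\text{in probability.}$$
   Context: Fix $\alpha\ge 2$. Let $(\xi_0(z))_{z\in\mathbb Z}$ be i.i.d. Pareto random variables with parameter $\alpha$, i.e. $\mathrm{Prob}(\xi_0(z)>x)=x^{-\alpha}$ for $x\ge 1$. Let $p:\mathbb N\to[0,1]$ be eventually nondecreasing with $p(n)\to 1$, and $q=1-p$ (extended to $(0,\infty)$ by $p(x)=p(\lceil x\rceil)$, $q(x)=q(\lceil x\rceil)$). Define the potential $\xi:\mathbb Z\to[1,\infty)$ by $\xi(n)=\xi_0(n)$ for $n\ge 0$ and, independently for each $n\ge1$ (and independently of $\xi_0$), $\xi(-n)=\xi_0(n)$ with probability $p(n)$ and $\xi(-n)=\xi_0(-n)$ with probability $q(n)$. $\mathrm{Prob}$ denotes the law of $\xi$. Let $u$ be the solution of $\partial_t u(t,z)=\Delta u(t,z)+\xi(z)u(t,z)$ on $(0,\infty)\times\mathbb Z$, $u(0,z)=\mathbf 1_{\{0\}}(z)$, where $(\Delta f)(z)=\sum_{|y-z|=1}(f(y)-f(z))$; it is given by the Feynman–Kac formula $u(t,z)=\mathbb E[\exp\{\int_0^t\xi(X_s)ds\}\mathbf 1\{X_t=z\}]$ with $(X_s)$ the continuous-time random walk on $\mathbb Z$ with generator $\Delta$ started at $0$. Let $U(t)=\sum_{z\in\mathbb Z}u(t,z)$. Let $D=\{z\in\mathbb N_0:\xi(z)=\xi(-z)\}$, $E=\mathbb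 N_0\setminus D$, $\Psi_t(z)=\xi(z)-\frac{|z|}{t}\log\xi(z)$, and let $Z^{(1)}_t$ be a maximiser of $\Psi_t$ over $D$ (which exists almost surely). *)

theory Defs
  imports "HOL-Probability.Probability"
begin

definition pam_potential :: "(int \<Rightarrow> real) \<Rightarrow> (nat \<Rightarrow> real) \<Rightarrow> int \<Rightarrow> real" where
  "pam_potential xi0 C z =
     (if z \<ge> 0 then xi0 z
      else if C (nat (- z)) = 1 then xi0 (- z) else xi0 z)"

text \<open>Feynman--Kac solution u(t,z) = E[exp(int_0^t xi(X_s) ds) 1{X_t = z}] for the
  continuous-time simple random walk with generator Delta (jump rate 1 to each neighbour),
  written as its expansion over the number n of jumps (last-jump decomposition):
  pam_v xi n t z is the contribution of paths making exactly n jumps.\<close>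
primrec pam_v :: "(int \<Rightarrow> real) \<Rightarrow> nat \<Rightarrow> real \<Rightarrow> int \<Rightarrow> ennreal" where
  "pam_v xi 0 t z = (if z = 0 then ennreal (exp ((xi 0 - 2) * t)) else 0)"
| "pam_v xi (Suc n) t z =
     (\<integral>\<^sup>+ s. indicator {0..t} s * ennreal (exp ((xi z - 2) * (t - s)))
            * (pam_v xi n s (z - 1) + pam_v xi n s (z + 1)) \<partial>lborel)"

definition pam_u :: "(int \<Rightarrow> real) \<Rightarrow> real \<Rightarrow> int \<Rightarrow> ennreal" where
  "pam_u xi t z = (\<Sum>n. pam_v xi n t z)"

definition pam_U :: "(int \<Rightarrow> real) \<Rightarrow> real \<Rightarrow> ennreal" where
  "pam_U xi t = (\<integral>\<^sup>+ z. pam_u xi t z \<partial>count_space UNIV)"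

definition pam_D :: "(int \<Rightarrow> real) \<Rightarrow> nat set" where
  "pam_D xi = {z. xi (int z) = xi (- int z)}"

definition pam_Psi :: "(int \<Rightarrow> real) \<Rightarrow> real \<Rightarrow> int \<Rightarrow> real" where
  "pam_Psi xi t z = xi z - (real_of_int \<bar>z\<bar> / t) * ln (xi z)"

end

theory Submission
  imports Defs "HOL-Real_Asymp.Real_Asymp"
begin

text \<open>
  Let \<open>W = u(t,Z) + u(t,-Z)\<close>. Running straight to \<open>Z\<close> and staying there gives
  \<open>ln W \<ge> t \<Psi>(Z) - Z - 2 t\<close>. Conversely, \<open>n\<close> jumps confined to sites with potential at most \<open>b\<close>
  contribute at most \<open>exp (b t) (2 t)^n / n!\<close>, and \<open>(2 t)^n / n!\<close> summed against \<open>exp (n l)\<close> is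
  \<open>exp (2 t exp l)\<close>; so if \<open>\<xi>(y) - \<bar>y\<bar> l / t \<le> B\<close> for all \<open>y \<noteq> \<plusminus>Z\<close>, all paths that avoid \<open>\<plusminus>Z\<close> or meet
  another site almost as high as \<open>Z\<close> together carry at most \<open>exp (t (B + \<eta> + 2 exp l))\<close>. The remaining paths
  visit \<open>\<plusminus>Z\<close> and otherwise only sites lower by \<open>\<eta>\<close>; those of them that end off \<open>\<plusminus>Z\<close> carry at
  most \<open>2 W / (\<eta> - 2)\<close>.

  It remains to see that \<open>\<Psi>(Z)\<close> exceeds such a \<open>B\<close> by more than the error terms. With
  \<open>a = (t / ln t)^(1/(\<alpha>-1))\<close>, the relevant sites lie at distance of order \<open>a^\<alpha>\<close> and have potential of
  order \<open>a\<close>. Union bounds give a gap of order \<open>a\<close> with high probability: two duplicated sites of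
  this kind rarely have values of \<open>\<xi>(y) - \<bar>y\<bar> l / t\<close> within \<open>\<delta> a\<close> of each other, and since \<open>q \<longlongrightarrow> 0\<close>
  non-duplicated sites at this distance do not reach height of order \<open>a\<close>. All errors are \<open>o(a)\<close>.
\<close>

section \<open>Estimates on the jump expansion\<close>

text \<open>In the notation of the jump expansion, \<open>pam_avoid A\<close> collects the paths that never enter
  \<open>A\<close> after time \<open>0\<close> and \<open>pam_hit A\<close> those that do.\<close>

primrec pam_avoid :: "int set \<Rightarrow> (int \<Rightarrow> real) \<Rightarrow> nat \<Rightarrow> real \<Rightarrow> int \<Rightarrow> ennreal" where
  "pam_avoid A xi 0 t z = (if z = 0 then ennreal (exp ((xi 0 - 2) * t)) else 0)"
| "pam_avoid A xi (Suc n) t z = (if z \<in> A then 0 else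
     (\<integral>\<^sup>+ s. indicator {0..t} s * ennreal (exp ((xi z - 2) * (t - s)))
            * (pam_avoid A xi n s (z - 1) + pam_avoid A xi n s (z + 1)) \<partial>lborel))"

primrec pam_hit :: "int set \<Rightarrow> (int \<Rightarrow> real) \<Rightarrow> nat \<Rightarrow> real \<Rightarrow> int \<Rightarrow> ennreal" where
  "pam_hit A xi 0 t z = 0"
| "pam_hit A xi (Suc n) t z = (if z \<in> A then pam_v xi (Suc n) t z else
     (\<integral>\<^sup>+ s. indicator {0..t} s * ennreal (exp ((xi z - 2) * (t - s)))
            * (pam_hit A xi n s (z - 1) + pam_hit A xi n s (z + 1)) \<partial>lborel))"

lemma pam_avoid_empty: "pam_avoid {} xi n t z = pam_v xi n t z"
  by (induction n arbitrary: t z) simp_all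

section \<open>Measurability in time and splitting of paths by visits to \<open>A\<close>\<close>

lemma borel_measurable_last_jump:
  fixes g :: "real \<Rightarrow> ennreal"
  assumes [measurable]: "g \<in> borel_measurable borel"
  shows "(\<lambda>t. \<integral>\<^sup>+ s. indicator {0..t} s * ennreal (exp (c * (t - s))) * g s \<partial>lborel)
           \<in> borel_measurable borel"
proof -
  \<comment> \<open>Written as a comparison of \<open>s\<close> with \<open>t\<close>, the moving
    interval leaves an integrand that is jointly measurable in \<open>(s, t)\<close>.\<close>
  have "(\<lambda>t. \<integral>\<^sup>+ s. (if 0 \<le> s \<and> s \<le> t then 1 else 0) * ennreal (exp (c * (t - s))) * g s \<partial>lborel)
           \<in> borel_measurable borel"
    by measurable
  then show ?thesis
    by (simp add: indicator_def atLeastAtMost_iff)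
qed

lemma pam_v_measurable [measurable]: "(\<lambda>t. pam_v xi n t z) \<in> borel_measurable borel"
proof (induction n arbitrary: z)
  case (Suc n)
  note [measurable] = Suc
  show ?case by (simp, rule borel_measurable_last_jump) measurable
qed simp

lemma pam_avoid_measurable [measurable]: "(\<lambda>t. pam_avoid A xi n t z) \<in> borel_measurable borel"
proof (induction n arbitrary: z)
  case (Suc n)
  note [measurable] = Suc
  show ?case
    by (cases "z \<in> A") (simp, simp, rule borel_measurable_last_jump, measurable)
qed simp

lemma pam_hit_measurable [measurable]: "(\<lambda>t. pam_hit A xi n t z) \<in> borel_measurable borel"
proof (induction n arbitrary: z)
  case (Suc n)
  note [measurable] = Suc
  show ?case
  proof (cases "z \<in> A")
    case True
    then show ?thesis using pam_v_measurable[of xi "Suc n" z] by simp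
  next
    case False
    then show ?thesis by (simp, rule_tac borel_measurable_last_jump) measurable
  qed
qed simp

lemma pam_u_measurable [measurable]: "(\<lambda>t. pam_u xi t z) \<in> borel_measurable borel"
  unfolding pam_u_def by measurable

text \<open>After at least one jump a path ending in \<open>A\<close> has met \<open>A\<close>; for
  other endpoints the last-jump integral is additive in the two classes of paths.\<close>

lemma pam_v_eq_avoid_plus_hit:
  assumes "0 \<notin> A"
  shows "pam_v xi n t z = pam_avoid A xi n t z + pam_hit A xi n t z"
proof (induction n arbitrary: t z)
  case (Suc n)
  show ?case
  proof (cases "z \<in> A")
    case False
    have "pam_v xi (Suc n) t z = 
       (\<integral>\<^sup>+ s. indicator {0..t} s * ennreal (exp ((xi z - 2) * (t - s)))
            * (pam_avoid A xi n s (z - 1) + pam_avoid A xi n s (z + 1))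
          + indicator {0..t} s * ennreal (exp ((xi z - 2) * (t - s)))
            * (pam_hit A xi n s (z - 1) + pam_hit A xi n s (z + 1)) \<partial>lborel)"
      by (simp add: Suc algebra_simps)
    also have "\<dots> = pam_avoid A xi (Suc n) t z + pam_hit A xi (Suc n) t z"
      using False by (subst nn_integral_add) simp_all
    finally show ?thesis .
  qed simp
qed (use assms in simp)

text \<open>Jumps go to nearest neighbours, so \<open>n\<close> of them reach distance at most
  \<open>n\<close>. For fixed \<open>n\<close> all sums over sites are therefore finite.\<close>

lemma pam_v_eq_0: "int n < \<bar>z\<bar> \<Longrightarrow> pam_v xi n t z = 0"
  by (induction n arbitrary: t z) auto

lemma pam_avoid_eq_0: "int n < \<bar>z\<bar> \<Longrightarrow> pam_avoid A xi n t z = 0"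
  by (induction n arbitrary: t z) auto

lemma pam_hit_eq_0: "int n < \<bar>z\<bar> \<Longrightarrow> pam_hit A xi n t z = 0"
  by (induction n arbitrary: t z) (auto simp: pam_v_eq_0)

section \<open>Paths confined to low sites\<close>

lemma nn_integral_pow_Icc:
  assumes "0 \<le> t" "0 \<le> c"
  shows "(\<integral>\<^sup>+ s. indicator {0..t} s * ennreal (c * s ^ n) \<partial>lborel) = ennreal (c * t ^ Suc n / real (Suc n))"
proof -
  have "(\<integral>\<^sup>+ s. ennreal (c * s ^ n) * indicator {0..t} s \<partial>lborel)
          = ennreal (c * t ^ Suc n / real (Suc n) - c * 0 ^ Suc n / real (Suc n))"
  proof (rule nn_integral_FTC_Icc)
    fix x assume "x \<in> {0..t}"
    show "0 \<le> c * x ^ n" using assms \<open>x \<in> {0..t}\<close> by simp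
    show "((\<lambda>x. c * x ^ Suc n / real (Suc n)) has_real_derivative c * x ^ n) (at x)"
      by (rule derivative_eq_intros refl | simp)+
  qed (use assms in auto)
  then show ?thesis by (simp add: mult.commute)
qed

text \<open>The holding factors along a path multiply to at most \<open>exp (b * t)\<close>, each
  jump has two directions, and the ordered jump times have volume \<open>t ^ n / fact n\<close>.
  \<open>F\<close> is arbitrary so that its two translates can be fed to the induction hypothesis;
  \<open>0 \<notin> A\<close> lets \<open>le\<close> cover the starting site.\<close>

lemma sum_pam_avoid_le:
  assumes "0 \<notin> A" "0 \<le> t" "finite F"
    and le: "\<And>z. \<bar>z\<bar> \<le> int n \<Longrightarrow> z \<notin> A \<Longrightarrow> xi z \<le> b"
  shows "(\<Sum>z\<in>F. pam_avoid A xi n t z) \<le> ennreal (exp (b * t) * ((2 * t) ^ n / fact n))"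
  using assms(2-)
proof (induction n arbitrary: t F)
  case 0
  have "(\<Sum>z\<in>F. pam_avoid A xi 0 t z) \<le> ennreal (exp ((xi 0 - 2) * t))"
    using 0 by (simp add: sum.delta)
  also have "\<dots> \<le> ennreal (exp (b * t))"
    using 0 assms(1) by (intro ennreal_leI) (simp, intro mult_right_mono, auto dest: 0(3)[of 0])
  finally show ?case by simp
next
  case (Suc n)
  let ?c = "exp (b * t) * 2 ^ Suc n / fact n"
  have IH: "(\<Sum>z\<in>F. pam_avoid A xi n s z) \<le> ennreal (exp (b * s) * ((2 * s) ^ n / fact n))"
    if "0 \<le> s" "finite F" for s F
    using that Suc.prems(3) by (intro Suc.IH) auto
  have "(\<Sum>z\<in>F. pam_avoid A xi (Suc n) t z) \<le> (\<Sum>z\<in>F. \<integral>\<^sup>+ s. indicator {0..t} s * ennreal (exp (b * (t - s)))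
            * (pam_avoid A xi n s (z - 1) + pam_avoid A xi n s (z + 1)) \<partial>lborel)"
  proof (rule sum_mono)
    fix z
    consider "z \<in> A" | "z \<notin> A" "\<bar>z\<bar> \<le> int (Suc n)" | "\<bar>z\<bar> > int (Suc n)" by linarith
    then show "pam_avoid A xi (Suc n) t z \<le> (\<integral>\<^sup>+ s. indicator {0..t} s * ennreal (exp (b * (t - s)))
            * (pam_avoid A xi n s (z - 1) + pam_avoid A xi n s (z + 1)) \<partial>lborel)"
    proof cases
      case 2
      then have "xi z - 2 \<le> b" using Suc.prems(3)[of z] by simp
      then show ?thesis using 2
        by (auto intro!: nn_integral_mono mult_right_mono ennreal_leI simp: indicator_def)
    qed (use pam_avoid_eq_0[of "Suc n" z A xi t] in auto)
  qed
  also have "\<dots> = (\<integral>\<^sup>+ s. (\<Sum>z\<in>F. indicator {0..t} s * ennreal (exp (b * (t - s)))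
            * (pam_avoid A xi n s (z - 1) + pam_avoid A xi n s (z + 1))) \<partial>lborel)"
    by (rule nn_integral_sum[symmetric]) measurable
  also have "\<dots> = (\<integral>\<^sup>+ s. indicator {0..t} s * ennreal (exp (b * (t - s)))
            * ((\<Sum>z\<in>(\<lambda>z. z - 1) ` F. pam_avoid A xi n s z) + (\<Sum>z\<in>(\<lambda>z. z + 1) ` F. pam_avoid A xi n s z)) \<partial>lborel)"
    by (simp add: sum_distrib_left[symmetric] sum.distrib sum.reindex inj_on_def)
  also have "\<dots> \<le> (\<integral>\<^sup>+ s. indicator {0..t} s * ennreal (?c * s ^ n) \<partial>lborel)"
  proof (rule nn_integral_mono)
    fix s :: real
    show "indicator {0..t} s * ennreal (exp (b * (t - s)))
            * ((\<Sum>z\<in>(\<lambda>z. z - 1) ` F. pam_avoid A xi n s z) + (\<Sum>z\<in>(\<lambda>z. z + 1) ` F. pam_avoid A xi n s z))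
          \<le> indicator {0..t} s * ennreal (?c * s ^ n)"
    proof (cases "s \<in> {0..t}")
      case True
      have "ennreal (exp (b * (t - s)))
            * ((\<Sum>z\<in>(\<lambda>z. z - 1) ` F. pam_avoid A xi n s z) + (\<Sum>z\<in>(\<lambda>z. z + 1) ` F. pam_avoid A xi n s z))
          \<le> ennreal (exp (b * (t - s))) * (ennreal (exp (b * s) * ((2 * s) ^ n / fact n)) + ennreal (exp (b * s) * ((2 * s) ^ n / fact n)))"
        using True Suc.prems by (intro mult_left_mono add_mono IH) auto
      also have "\<dots> = ennreal (exp (b * (t - s)) * (exp (b * s) * ((2 * s) ^ n / fact n) + exp (b * s) * ((2 * s) ^ n / fact n)))"
        using True by (subst ennreal_plus[symmetric]) (simp_all add: ennreal_mult'[symmetric] del: times_divide_eq_right)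
      also have "exp (b * (t - s)) * (exp (b * s) * ((2 * s) ^ n / fact n) + exp (b * s) * ((2 * s) ^ n / fact n)) = ?c * s ^ n"
      proof -
        have "exp (b * t) = exp (b * (t - s)) * exp (b * s)" by (simp add: exp_add[symmetric] algebra_simps)
        then show ?thesis by (simp add: power_mult_distrib)
      qed
      finally show ?thesis using True by simp
    qed simp
  qed
  also have "\<dots> = ennreal (?c * t ^ Suc n / real (Suc n))"
    using Suc.prems by (intro nn_integral_pow_Icc) auto
  also have "?c * t ^ Suc n / real (Suc n) = exp (b * t) * ((2 * t) ^ Suc n / fact (Suc n))"
    by (simp add: power_mult_distrib field_simps)
  finally show ?case .
qed

section \<open>Mass leaked from a set of equally high sites\<close>

lemma pam_u_mono_time:
  assumes "0 \<le> s" "s \<le> t"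
  shows "ennreal (exp ((xi z - 2) * (t - s))) * pam_u xi s z \<le> pam_u xi t z"
proof -
  have "ennreal (exp ((xi z - 2) * (t - s))) * pam_v xi n s z \<le> pam_v xi n t z" for n
  proof (cases n)
    case 0
    then show ?thesis by (simp add: ennreal_mult'[symmetric] exp_add[symmetric] algebra_simps)
  next
    case (Suc m)
    have "ennreal (exp ((xi z - 2) * (t - s))) * pam_v xi n s z =
       (\<integral>\<^sup>+ r. ennreal (exp ((xi z - 2) * (t - s))) * (indicator {0..s} r * ennreal (exp ((xi z - 2) * (s - r)))
            * (pam_v xi m r (z - 1) + pam_v xi m r (z + 1))) \<partial>lborel)"
      unfolding Suc pam_v.simps by (rule nn_integral_cmult[symmetric]) measurable
    also have "\<dots> = (\<integral>\<^sup>+ r. indicator {0..s} r * ennreal (exp ((xi z - 2) * (t - r)))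
            * (pam_v xi m r (z - 1) + pam_v xi m r (z + 1)) \<partial>lborel)"
    proof (rule nn_integral_cong)
      fix r
      have "ennreal (exp ((xi z - 2) * (t - r))) = ennreal (exp ((xi z - 2) * (t - s))) * ennreal (exp ((xi z - 2) * (s - r)))"
        by (simp add: ennreal_mult'[symmetric] exp_add[symmetric] algebra_simps)
      then show "ennreal (exp ((xi z - 2) * (t - s))) * (indicator {0..s} r * ennreal (exp ((xi z - 2) * (s - r)))
            * (pam_v xi m r (z - 1) + pam_v xi m r (z + 1))) = indicator {0..s} r * ennreal (exp ((xi z - 2) * (t - r)))
            * (pam_v xi m r (z - 1) + pam_v xi m r (z + 1))"
        by (simp add: ac_simps)
    qed
    \<comment> \<open>Paths whose last jump comes before \<open>s\<close> are part of those whose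
      last jump comes before \<open>t\<close>; they wait at \<open>z\<close> for the extra time
      \<open>t - s\<close>.\<close>
    also have "\<dots> \<le> pam_v xi n t z"
      unfolding Suc pam_v.simps using assms
      by (intro nn_integral_mono mult_right_mono) (auto simp: indicator_def)
    finally show ?thesis .
  qed
  then show ?thesis
    unfolding pam_u_def ennreal_suminf_cmult[symmetric] by (intro suminf_le) auto
qed

lemma nn_integral_exp_decay_le:
  assumes "0 < c" "0 \<le> t"
  shows "(\<integral>\<^sup>+ s. indicator {0..t} s * ennreal (exp (- c * (t - s))) \<partial>lborel) \<le> ennreal (1 / c)"
proof -
  have "(\<integral>\<^sup>+ s. ennreal (exp (- c * (t - s))) * indicator {0..t} s \<partial>lborel)
          = ennreal (exp (- c * (t - t)) / c - exp (- c * (t - 0)) / c)"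
  proof (rule nn_integral_FTC_Icc)
    fix x assume "x \<in> {0..t}"
    show "((\<lambda>x. exp (- c * (t - x)) / c) has_real_derivative exp (- c * (t - x))) (at x)"
      using assms by (auto intro!: derivative_eq_intros)
  qed (use assms in auto)
  also have "\<dots> \<le> ennreal (1 / c)"
    using assms by (intro ennreal_leI) simp
  finally show ?thesis by (simp add: mult.commute)
qed


lemma pam_hit_le_pam_v: "z \<in> A \<Longrightarrow> pam_hit A xi n t z \<le> pam_v xi n t z"
  by (cases n) auto

text \<open>The range is tied to the number of jumps because a path with \<open>n\<close> jumps sees
  nothing further out. With \<open>b = x - eta\<close> no site off \<open>A\<close> seen by such a
  path competes with \<open>A\<close>.\<close>

definition low_up_to :: "int set \<Rightarrow> (int \<Rightarrow> real) \<Rightarrow> real \<Rightarrow> nat \<Rightarrow> bool" where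
  "low_up_to A xi b n \<longleftrightarrow> (\<forall>z. \<bar>z\<bar> \<le> int n \<longrightarrow> z \<notin> A \<longrightarrow> xi z \<le> b)"

lemma low_up_to_Suc: "low_up_to A xi b (Suc n) \<Longrightarrow> low_up_to A xi b n"
  unfolding low_up_to_def by force

text \<open>Off \<open>A\<close> the mass grows at rate at most \<open>x - eta\<close>, while on \<open>A\<close> the solution grows at rate at
  least \<open>x - 2\<close>. Hence the mass leaked from \<open>A\<close> to low sites stays a small multiple of the mass
  on \<open>A\<close>, and this bound reproduces itself under the last-jump recursion.\<close>

lemma sum_pam_hit_le:
  fixes x eta :: real
  assumes "finite A" "\<And>z. z \<in> A \<Longrightarrow> xi z = x" "2 < eta"
    and "0 \<le> t" "finite F" "F \<inter> A = {}"
  shows "(\<Sum>n<N. if low_up_to A xi (x - eta) n then \<Sum>z\<in>F. pam_hit A xi n t z else 0)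
           \<le> ennreal (2 / (eta - 2)) * (\<Sum>z\<in>A. pam_u xi t z)"
  using assms(4-)
proof (induction N arbitrary: t F)
  case 0
  then show ?case by simp
next
  case (Suc N)
  let ?low = "low_up_to A xi (x - eta)"
  \<comment> \<open>Solution of \<open>2 * (\<kappa> + 1) / eta = \<kappa>\<close>, the identity
    that closes the induction.\<close>
  define \<kappa> where "\<kappa> = 2 / (eta - 2)"
  define W where "W s = (\<Sum>z\<in>A. pam_u xi s z)" for s
  define E where "E s = ennreal (exp ((x - eta - 2) * (t - s)))" for s
  define g where "g n s G = (if ?low n then \<Sum>z\<in>G. pam_hit A xi n s z else 0)" for n s G
  have \<kappa>0: "0 < \<kappa>" using assms(3) by (simp add: \<kappa>_def)
  have W_meas [measurable]: "W \<in> borel_measurable borel" unfolding W_def[abs_def] by measurable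
  have E_meas [measurable]: "E \<in> borel_measurable borel" unfolding E_def[abs_def] by measurable
  have g_meas [measurable]: "(\<lambda>s. g n s G) \<in> borel_measurable borel" for n G
    unfolding g_def[abs_def] by measurable
  \<comment> \<open>On \<open>G - A\<close> the induction hypothesis gives
    \<open>\<kappa> * W s\<close>; on \<open>A\<close> all paths together give at most
    \<open>W s\<close>.\<close>
  have split: "(\<Sum>n<N. g n s G) \<le> ennreal (\<kappa> + 1) * W s" if "0 \<le> s" "finite G" for s G
  proof -
    have "(\<Sum>n<N. g n s G) \<le> (\<Sum>n<N. g n s (G - A) + (\<Sum>z\<in>A. pam_v xi n s z))"
    proof (rule sum_mono)
      fix n
      have "g n s G \<le> g n s (G - A) + (\<Sum>z\<in>G \<inter> A. pam_hit A xi n s z)"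
        unfolding g_def using that(2) sum.Int_Diff[of G "\<lambda>z. pam_hit A xi n s z" A]
        by (simp add: add.commute)
      also have "(\<Sum>z\<in>G \<inter> A. pam_hit A xi n s z) \<le> (\<Sum>z\<in>G \<inter> A. pam_v xi n s z)"
        by (intro sum_mono pam_hit_le_pam_v) auto
      also have "\<dots> \<le> (\<Sum>z\<in>A. pam_v xi n s z)"
        using assms(1) by (intro sum_mono2) auto
      finally show "g n s G \<le> g n s (G - A) + (\<Sum>z\<in>A. pam_v xi n s z)"
        by (simp add: add_mono)
    qed
    also have "\<dots> = (\<Sum>n<N. g n s (G - A)) + (\<Sum>z\<in>A. \<Sum>n<N. pam_v xi n s z)"
      by (simp add: sum.distrib sum.swap[of _ A])
    also have "\<dots> \<le> ennreal \<kappa> * W s + W s"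
    proof (rule add_mono)
      show "(\<Sum>n<N. g n s (G - A)) \<le> ennreal \<kappa> * W s"
        unfolding g_def \<kappa>_def W_def using that by (intro Suc.IH) auto
      show "(\<Sum>z\<in>A. \<Sum>n<N. pam_v xi n s z) \<le> W s"
        unfolding W_def pam_u_def by (intro sum_mono sum_le_suminf) auto
    qed
    also have "\<dots> = ennreal (\<kappa> + 1) * W s"
      using \<kappa>0 by (simp add: ennreal_plus distrib_right)
    finally show ?thesis .
  qed
  \<comment> \<open>Lowness within \<open>Suc n\<close> jumps passes to \<open>n\<close> jumps, so
    the cutoff survives the recursion; where it fails the left side is \<open>0\<close>.\<close>
  have step: "g (Suc n) t F \<le> (\<integral>\<^sup>+ s. indicator {0..t} s * E s
      * (g n s ((\<lambda>z. z - 1) ` F) + g n s ((\<lambda>z. z + 1) ` F)) \<partial>lborel)" for n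
  proof (cases "?low (Suc n)")
    case True
    have "g (Suc n) t F \<le> (\<Sum>z\<in>F. \<integral>\<^sup>+ s. indicator {0..t} s * E s
            * (pam_hit A xi n s (z - 1) + pam_hit A xi n s (z + 1)) \<partial>lborel)"
      unfolding g_def if_P[OF True]
    proof (rule sum_mono)
      fix z assume "z \<in> F"
      then have zA: "z \<notin> A" using Suc.prems by auto
      show "pam_hit A xi (Suc n) t z \<le> (\<integral>\<^sup>+ s. indicator {0..t} s * E s
            * (pam_hit A xi n s (z - 1) + pam_hit A xi n s (z + 1)) \<partial>lborel)"
      proof (cases "\<bar>z\<bar> \<le> int (Suc n)")
        case z: True
        then have "xi z \<le> x - eta" using True zA unfolding low_up_to_def by blast
        then show ?thesis using zA unfolding E_def
          by (auto intro!: nn_integral_mono mult_right_mono ennreal_leI simp: indicator_def)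
      next
        case False
        then show ?thesis using pam_hit_eq_0[of "Suc n" z A xi t] by simp
      qed
    qed
    also have "\<dots> = (\<integral>\<^sup>+ s. (\<Sum>z\<in>F. indicator {0..t} s * E s
            * (pam_hit A xi n s (z - 1) + pam_hit A xi n s (z + 1))) \<partial>lborel)"
      by (rule nn_integral_sum[symmetric]) measurable
    also have "\<dots> = (\<integral>\<^sup>+ s. indicator {0..t} s * E s
      * (g n s ((\<lambda>z. z - 1) ` F) + g n s ((\<lambda>z. z + 1) ` F)) \<partial>lborel)"
      using low_up_to_Suc[OF True]
      by (simp add: g_def sum_distrib_left[symmetric] sum.distrib sum.reindex inj_on_def)
    finally show ?thesis .
  qed (simp add: g_def)
  \<comment> \<open>Without a jump nothing has hit \<open>A\<close>, so the term for
    \<open>n = 0\<close> vanishes and the index shifts.\<close>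
  have "(\<Sum>n<Suc N. g n t F) = (\<Sum>n<N. g (Suc n) t F)"
    unfolding sum.lessThan_Suc_shift by (simp add: g_def)
  also have "\<dots> \<le> (\<Sum>n<N. \<integral>\<^sup>+ s. indicator {0..t} s * E s
      * (g n s ((\<lambda>z. z - 1) ` F) + g n s ((\<lambda>z. z + 1) ` F)) \<partial>lborel)"
    by (intro sum_mono step)
  also have "\<dots> = (\<integral>\<^sup>+ s. (\<Sum>n<N. indicator {0..t} s * E s
      * (g n s ((\<lambda>z. z - 1) ` F) + g n s ((\<lambda>z. z + 1) ` F))) \<partial>lborel)"
    by (rule nn_integral_sum[symmetric]) measurable
  also have "\<dots> = (\<integral>\<^sup>+ s. indicator {0..t} s * E s
      * ((\<Sum>n<N. g n s ((\<lambda>z. z - 1) ` F)) + (\<Sum>n<N. g n s ((\<lambda>z. z + 1) ` F))) \<partial>lborel)"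
    by (simp add: sum_distrib_left[symmetric] sum.distrib)
  also have "\<dots> \<le> (\<integral>\<^sup>+ s. (ennreal (2 * (\<kappa> + 1)) * W t) * (indicator {0..t} s * ennreal (exp (- eta * (t - s)))) \<partial>lborel)"
  proof (rule nn_integral_mono)
    fix s
    show "indicator {0..t} s * E s
      * ((\<Sum>n<N. g n s ((\<lambda>z. z - 1) ` F)) + (\<Sum>n<N. g n s ((\<lambda>z. z + 1) ` F)))
      \<le> (ennreal (2 * (\<kappa> + 1)) * W t) * (indicator {0..t} s * ennreal (exp (- eta * (t - s))))"
    proof (cases "s \<in> {0..t}")
      case True
      have "E s * ((\<Sum>n<N. g n s ((\<lambda>z. z - 1) ` F)) + (\<Sum>n<N. g n s ((\<lambda>z. z + 1) ` F)))
        \<le> E s * (ennreal (\<kappa> + 1) * W s + ennreal (\<kappa> + 1) * W s)"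
        using True Suc.prems by (intro mult_left_mono add_mono split) auto
      also have "\<dots> = ennreal (2 * (\<kappa> + 1)) * (ennreal (exp (- eta * (t - s))) * (ennreal (exp ((x - 2) * (t - s))) * W s))"
      proof -
        have "E s = ennreal (exp (- eta * (t - s))) * ennreal (exp ((x - 2) * (t - s)))"
          unfolding E_def by (simp add: ennreal_mult'[symmetric] exp_add[symmetric] algebra_simps)
        moreover have "ennreal (2 * (\<kappa> + 1)) = 2 * ennreal (\<kappa> + 1)"
          using \<kappa>0 by (simp add: ennreal_mult')
        ultimately show ?thesis by (simp add: ac_simps mult_2[symmetric])
      qed
      \<comment> \<open>Waiting on \<open>A\<close> until \<open>t\<close> absorbs the factor
        growing at rate \<open>x - 2\<close>; what remains is \<open>exp (- eta * (t - s))\<close>,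
        with integral at most \<open>1 / eta\<close>.\<close>
      also have "ennreal (exp ((x - 2) * (t - s))) * W s \<le> W t"
      proof -
        have "ennreal (exp ((x - 2) * (t - s))) * pam_u xi s z \<le> pam_u xi t z" if "z \<in> A" for z
          using pam_u_mono_time[of s t xi z] True assms(2)[OF that] by simp
        then show ?thesis unfolding W_def sum_distrib_left by (intro sum_mono)
      qed
      finally show ?thesis using True by (simp add: ac_simps mult_right_mono)
    qed simp
  qed
  also have "\<dots> = ennreal (2 * (\<kappa> + 1)) * W t * (\<integral>\<^sup>+ s. indicator {0..t} s * ennreal (exp (- eta * (t - s))) \<partial>lborel)"
    by (rule nn_integral_cmult) measurable
  also have "\<dots> \<le> ennreal (2 * (\<kappa> + 1)) * W t * ennreal (1 / eta)"
    using assms(3) Suc.prems by (intro mult_left_mono nn_integral_exp_decay_le) auto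
  also have "\<dots> = ennreal (2 * (\<kappa> + 1) * (1 / eta)) * W t"
    using \<kappa>0 assms(3)
    by (subst ennreal_mult[of "2 * (\<kappa> + 1)" "1 / eta"]) (simp_all only: ac_simps, simp_all)
  also have "2 * (\<kappa> + 1) * (1 / eta) = \<kappa>"
    using assms(3) by (simp add: \<kappa>_def field_simps)
  finally show ?case unfolding g_def \<kappa>_def W_def .
qed

section \<open>Lower bound along the direct path\<close>

lemma pam_v_direct_path_step:
  assumes "0 \<le> s" "s \<le> t" "0 \<le> xi (int (Suc m))"
    and IH: "\<And>r. 0 \<le> r \<Longrightarrow> ennreal (exp (- 2 * r) * r ^ m / fact m) \<le> pam_v xi m r (int m)"
  shows "ennreal (exp (- 2 * t) * exp (xi (int (Suc m)) * (t - s)) * s ^ Suc m / fact (Suc m))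
           \<le> pam_v xi (Suc m) t (int (Suc m))"
proof -
  let ?x = "xi (int (Suc m))"
  let ?c = "exp (- 2 * t) * exp (?x * (t - s)) / fact m"
  have "ennreal (exp (- 2 * t) * exp (?x * (t - s)) * s ^ Suc m / fact (Suc m)) = ennreal (?c * s ^ Suc m / real (Suc m))"
    by (simp add: field_simps)
  also have "\<dots> = (\<integral>\<^sup>+ r. indicator {0..s} r * ennreal (?c * r ^ m) \<partial>lborel)"
    using assms by (intro nn_integral_pow_Icc[symmetric]) auto
  \<comment> \<open>Only arrivals at times \<open>r \<le> s\<close> are kept; they leave at least
    \<open>t - s\<close> for collecting the potential of the endpoint. The parameter
    \<open>s\<close> is free: the induction along the path takes \<open>s = t\<close>, the final
    estimate an optimal \<open>s\<close>.\<close>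
  also have "\<dots> \<le> (\<integral>\<^sup>+ r. indicator {0..t} r * ennreal (exp ((?x - 2) * (t - r)))
            * (pam_v xi m r (int (Suc m) - 1) + pam_v xi m r (int (Suc m) + 1)) \<partial>lborel)"
  proof (rule nn_integral_mono)
    fix r
    show "indicator {0..s} r * ennreal (?c * r ^ m) \<le> indicator {0..t} r * ennreal (exp ((?x - 2) * (t - r)))
            * (pam_v xi m r (int (Suc m) - 1) + pam_v xi m r (int (Suc m) + 1))"
    proof (cases "r \<in> {0..s}")
      case True
      have "?x * (t - s) \<le> ?x * (t - r)" using True assms by (intro mult_left_mono) auto
      then have "exp (- 2 * t) * exp (?x * (t - s)) \<le> exp ((?x - 2) * (t - r)) * exp (- 2 * r)"
        by (simp add: exp_add[symmetric] algebra_simps)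
      then have "exp (- 2 * t) * exp (?x * (t - s)) * (r ^ m / fact m) \<le> exp ((?x - 2) * (t - r)) * exp (- 2 * r) * (r ^ m / fact m)"
        using True by (intro mult_right_mono) auto
      then have "ennreal (?c * r ^ m) \<le> ennreal (exp ((?x - 2) * (t - r)) * (exp (- 2 * r) * r ^ m / fact m))"
        by (intro ennreal_leI) simp
      also have "\<dots> = ennreal (exp ((?x - 2) * (t - r))) * ennreal (exp (- 2 * r) * r ^ m / fact m)"
        by (rule ennreal_mult') simp
      also have "\<dots> \<le> ennreal (exp ((?x - 2) * (t - r))) * (pam_v xi m r (int (Suc m) - 1) + pam_v xi m r (int (Suc m) + 1))"
        using IH[of r] True by (intro mult_left_mono) (auto intro: order_trans[OF _ add_increasing2[OF _ order_refl]])
      finally show ?thesis using True assms by simp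
    qed simp
  qed
  finally show ?thesis by simp
qed

lemma pam_v_direct_path:
  assumes "\<And>z. 0 \<le> xi z" "0 \<le> r"
  shows "ennreal (exp (- 2 * r) * r ^ m / fact m) \<le> pam_v xi m r (int m)"
  using assms(2)
proof (induction m arbitrary: r)
  case 0
  have "- 2 * r \<le> (xi 0 - 2) * r" using assms(1)[of 0] 0 by (intro mult_right_mono) auto
  then show ?case by (simp add: ennreal_leI)
next
  case (Suc m)
  show ?case using pam_v_direct_path_step[of r r xi m] Suc assms(1) by simp
qed

text \<open>Inserting \<open>s = n / xi (int n)\<close> into the direct path bound and using
  \<open>fact n \<le> n ^ n\<close> turns the cost of travelling into
  \<open>n * ln (xi (int n)) + n\<close>. The condition \<open>n \<le> t * xi (int n)\<close> says
  that \<open>s \<le> t\<close>.\<close>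

lemma pam_u_lower_bound:
  assumes nonneg: "\<And>z. 0 \<le> xi z" and "0 < n" "0 < xi (int n)" "real n \<le> t * xi (int n)"
  shows "ennreal (exp (t * xi (int n) - real n * ln (xi (int n)) - real n - 2 * t)) \<le> pam_u xi t (int n)"
proof -
  obtain m where m: "n = Suc m" using \<open>0 < n\<close> gr0_conv_Suc by blast
  let ?x = "xi (int n)"
  \<comment> \<open>The time spent travelling that maximises \<open>s ^ n * exp (- ?x * s)\<close>.\<close>
  define s where "s = real n / ?x"
  have s: "0 < s" "s \<le> t" using assms by (auto simp: s_def field_simps)
  have "exp (t * ?x - real n * ln ?x - real n - 2 * t) = exp (- 2 * t) * exp (?x * (t - s)) * exp (- (real n * ln ?x))"
    using assms by (simp add: s_def exp_add[symmetric] algebra_simps)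
  also have "exp (- (real n * ln ?x)) = 1 / ?x ^ n"
    using assms by (simp add: exp_minus exp_of_nat_mult inverse_eq_divide)
  also have "\<dots> \<le> s ^ n / fact n"
  proof -
    have "fact n \<le> (real n) ^ n" using fact_le_power[of n] by simp
    then show ?thesis using assms by (simp add: s_def power_divide field_simps)
  qed
  finally have "ennreal (exp (t * ?x - real n * ln ?x - real n - 2 * t)) 
      \<le> ennreal (exp (- 2 * t) * exp (?x * (t - s)) * s ^ n / fact n)"
    by (intro ennreal_leI) simp
  also have "\<dots> \<le> pam_v xi n t (int n)"
    unfolding m using s nonneg by (intro pam_v_direct_path_step pam_v_direct_path) (auto simp: m)
  also have "\<dots> \<le> pam_u xi t (int n)"
    unfolding pam_u_def using sum_le_suminf[of "\<lambda>n. pam_v xi n t (int m + 1)" "{n}"] m by (simp add: add.commute)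
  finally show ?thesis .
qed

section \<open>Total mass off the peaks\<close>

lemma sum_jump_bound_le:
  fixes t l B :: real
  assumes "0 < t"
  shows "(\<Sum>n<N. ennreal (exp ((B + real n * l / t) * t) * ((2 * t) ^ n / fact n)))
           \<le> ennreal (exp (t * (B + 2 * exp l)))"
proof -
  have "exp ((B + real n * l / t) * t) * ((2 * t) ^ n / fact n) = exp (B * t) * ((2 * t * exp l) ^ n / fact n)" for n
    using assms by (simp add: exp_add exp_of_nat_mult[symmetric] power_mult_distrib algebra_simps)
  then have "(\<Sum>n<N. ennreal (exp ((B + real n * l / t) * t) * ((2 * t) ^ n / fact n)))
     = ennreal (exp (B * t) * (\<Sum>n<N. (2 * t * exp l) ^ n / fact n))"
    using assms by (subst sum_ennreal) (auto simp: sum_distrib_left)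
  also have "\<dots> \<le> ennreal (exp (B * t) * exp (2 * t * exp l))"
  proof (intro ennreal_leI mult_left_mono)
    show "(\<Sum>n<N. (2 * t * exp l) ^ n / fact n) \<le> exp (2 * t * exp l)"
    using assms exp_converges[of "2 * t * exp l"]
      sum_le_suminf[of "\<lambda>n. (2 * t * exp l) ^ n /\<^sub>R fact n" "{..<N}"]
    by (simp add: divide_inverse mult.commute sums_iff)
  qed simp
  finally show ?thesis by (simp add: exp_add[symmetric] algebra_simps)
qed

text \<open>\<open>enn2real\<close> sends infinity to \<open>0\<close>, so the quotient of masses
  reflects their true ratio only once they are known to be finite. The bound is the one for avoiding
  paths with \<open>A = {}\<close>, summed over the number of jumps.\<close>

lemma pam_u_finite:
  fixes t l B :: real
  assumes "0 < t" "0 \<le> l" and B: "\<And>y. xi y \<le> B + \<bar>real_of_int y\<bar> * l / t"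
  shows "pam_u xi t z < \<infinity>"
proof -
  have "(\<Sum>n<N. pam_v xi n t z) \<le> ennreal (exp (t * (B + 2 * exp l)))" for N
  proof -
    have "pam_v xi n t z \<le> ennreal (exp ((B + real n * l / t) * t) * ((2 * t) ^ n / fact n))" for n
    proof -
      have "xi y \<le> B + real n * l / t" if "\<bar>y\<bar> \<le> int n" for y
      proof -
        have "\<bar>real_of_int y\<bar> \<le> real n" using that by linarith
        then have "\<bar>real_of_int y\<bar> * l / t \<le> real n * l / t"
          using assms by (intro divide_right_mono mult_right_mono) auto
        then show ?thesis using B[of y] by linarith
      qed
      then show ?thesis
        using sum_pam_avoid_le[of "{}" t "{z}" n xi "B + real n * l / t"] assms(1)
        by (simp add: pam_avoid_empty)
    qed
    then have "(\<Sum>n<N. pam_v xi n t z) \<le> (\<Sum>n<N. ennreal (exp ((B + real n * l / t) * t) * ((2 * t) ^ n / fact n)))"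
      by (intro sum_mono)
    also note sum_jump_bound_le[OF assms(1)]
    finally show ?thesis .
  qed
  then have "pam_u xi t z \<le> ennreal (exp (t * (B + 2 * exp l)))"
    unfolding pam_u_def suminf_eq_SUP by (intro SUP_least)
  then show ?thesis by (metis ennreal_less_top infinity_ennreal_def le_less_trans)
qed

text \<open>Each jump number \<open>n\<close> is treated on its own. If no site within reach
  competes with \<open>A\<close>, the paths split into avoiding and hitting ones; otherwise the
  bound with empty avoided set covers all of them.\<close>

lemma pam_mass_outside_le:
  fixes x eta t l B :: real
  assumes "finite A" "0 \<notin> A" "\<And>z. z \<in> A \<Longrightarrow> xi z = x" "2 < eta" "0 < t" "0 \<le> l"
    and B: "\<And>y. y \<notin> A \<Longrightarrow> xi y \<le> B + \<bar>real_of_int y\<bar> * l / t"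
  shows "(\<integral>\<^sup>+ z. pam_u xi t z * indicator (- A) z \<partial>count_space UNIV)
     \<le> ennreal (2 / (eta - 2)) * (\<Sum>z\<in>A. pam_u xi t z) + ennreal (exp (t * (B + eta + 2 * exp l)))"
    (is "_ \<le> ?R")
proof -
  let ?low = "low_up_to A xi (x - eta)"
  let ?b = "\<lambda>n. B + eta + real n * l / t"
  have Bn: "xi y \<le> B + real n * l / t" if "\<bar>y\<bar> \<le> int n" "y \<notin> A" for y n
  proof -
    have "\<bar>real_of_int y\<bar> \<le> real n" using that by linarith
    then have "\<bar>real_of_int y\<bar> * l / t \<le> real n * l / t"
      using assms by (intro divide_right_mono mult_right_mono) auto
    then show ?thesis using B[of y] that by linarith
  qed
  have vn: "(\<Sum>z\<in>F. pam_v xi n t z) \<le> (if ?low n then \<Sum>z\<in>F. pam_hit A xi n t z else 0)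
      + ennreal (exp (?b n * t) * ((2 * t) ^ n / fact n))" if F: "finite F" for n F
  proof (cases "?low n")
    case True
    have "(\<Sum>z\<in>F. pam_avoid A xi n t z) \<le> ennreal (exp (?b n * t) * ((2 * t) ^ n / fact n))"
    proof (rule sum_pam_avoid_le)
      show "xi z \<le> ?b n" if "\<bar>z\<bar> \<le> int n" "z \<notin> A" for z
        using Bn[OF that] assms(4) by linarith
    qed (use assms F in auto)
    then show ?thesis using True
      by (simp add: pam_v_eq_avoid_plus_hit[OF assms(2)] sum.distrib add.commute add_mono)
  next
    case False
    \<comment> \<open>A site within \<open>eta\<close> of the height of \<open>A\<close> is in reach, so \<open>B\<close> controls the height of \<open>A\<close> as well.\<close>
    then obtain y where y: "\<bar>y\<bar> \<le> int n" "y \<notin> A" "xi y > x - eta"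
      unfolding low_up_to_def by force
    have "(\<Sum>z\<in>F. pam_avoid {} xi n t z) \<le> ennreal (exp (?b n * t) * ((2 * t) ^ n / fact n))"
    proof (rule sum_pam_avoid_le)
      show "xi z \<le> ?b n" if "\<bar>z\<bar> \<le> int n" for z
        using Bn[OF y(1,2)] y(3) assms(3)[of z] Bn[OF that] assms(4) by (cases "z \<in> A") auto
    qed (use assms F in auto)
    then show ?thesis using False by (simp add: pam_avoid_empty)
  qed
  have part: "(\<Sum>n<N. \<integral>\<^sup>+ z. pam_v xi n t z * indicator (- A) z \<partial>count_space UNIV) \<le> ?R" for N
  proof -
    \<comment> \<open>Fewer than \<open>N\<close> jumps stay within distance \<open>N\<close>, so
      the integral over sites is a finite sum.\<close>
    define F where "F = {- int N..int N} - A"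
    have F: "finite F" "F \<inter> A = {}" by (auto simp: F_def)
    have "(\<Sum>n<N. \<integral>\<^sup>+ z. pam_v xi n t z * indicator (- A) z \<partial>count_space UNIV) = (\<Sum>n<N. \<Sum>z\<in>F. pam_v xi n t z)"
    proof (rule sum.cong)
      fix n assume "n \<in> {..<N}"
      then have 0: "pam_v xi n t z * indicator (- A) z = 0" if "z \<notin> F" for z
        using that pam_v_eq_0[of n z xi t] by (cases "z \<in> A") (auto simp: F_def)
      have "(\<integral>\<^sup>+ z. pam_v xi n t z * indicator (- A) z \<partial>count_space UNIV) = (\<Sum>z\<in>F. pam_v xi n t z * indicator (- A) z)"
        by (rule nn_integral_count_space') (use F 0 in auto)
      also have "\<dots> = (\<Sum>z\<in>F. pam_v xi n t z)" by (rule sum.cong) (auto simp: F_def)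
      finally show "(\<integral>\<^sup>+ z. pam_v xi n t z * indicator (- A) z \<partial>count_space UNIV) = (\<Sum>z\<in>F. pam_v xi n t z)" .
    qed simp
    also have "\<dots> \<le> (\<Sum>n<N. (if ?low n then \<Sum>z\<in>F. pam_hit A xi n t z else 0)
      + ennreal (exp (?b n * t) * ((2 * t) ^ n / fact n)))"
      by (intro sum_mono vn F)
    also have "\<dots> \<le> ?R"
      unfolding sum.distrib using assms F
      by (intro add_mono sum_pam_hit_le sum_jump_bound_le) auto
    finally show ?thesis .
  qed
  have "(\<integral>\<^sup>+ z. pam_u xi t z * indicator (- A) z \<partial>count_space UNIV) = (\<Sum>n. \<integral>\<^sup>+ z. pam_v xi n t z * indicator (- A) z \<partial>count_space UNIV)"
    unfolding pam_u_def ennreal_suminf_multc[symmetric] by (rule nn_integral_suminf) simp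
  also have "\<dots> \<le> ?R" unfolding suminf_eq_SUP by (intro SUP_least part)
  finally show ?thesis .
qed

text \<open>With \<open>U = W + R\<close> the error is at most \<open>R / W\<close>. The surplus
  \<open>c\<close> in \<open>gap\<close> puts the direct path bound for \<open>W\<close> a factor
  \<open>exp (c * t)\<close> above the additive error in \<open>R\<close>; the leaked part of
  \<open>R\<close> is already a multiple of \<open>W\<close>.\<close>

lemma pam_localisation:
  fixes eta t l B c :: real and xi :: "int \<Rightarrow> real" and Z :: nat
  assumes nonneg: "\<And>z. 0 \<le> xi z" and "2 < eta" "0 < t" "0 \<le> l" "0 \<le> c"
    and Z: "0 < Z" "xi (int Z) = xi (- int Z)" "0 < xi (int Z)" "real Z \<le> t * xi (int Z)"
    and B: "\<And>y. y \<noteq> int Z \<Longrightarrow> y \<noteq> - int Z \<Longrightarrow> xi y \<le> B + \<bar>real_of_int y\<bar> * l / t"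
    and gap: "B + eta + 2 * exp l + c \<le> pam_Psi xi t (int Z) - real Z / t - 2"
  shows "\<bar>(enn2real (pam_u xi t (int Z)) + enn2real (pam_u xi t (- int Z))) / enn2real (pam_U xi t) - 1\<bar>
           \<le> 2 / (eta - 2) + exp (- c * t)"
proof -
  define A where "A = {int Z, - int Z}"
  define W where "W = (\<Sum>z\<in>A. pam_u xi t z)"
  define R where "R = (\<integral>\<^sup>+ z. pam_u xi t z * indicator (- A) z \<partial>count_space UNIV)"
  have W_eq: "W = pam_u xi t (int Z) + pam_u xi t (- int Z)"
    using Z(1) by (simp add: W_def A_def)
  have fin: "pam_u xi t z < \<infinity>" for z
  proof (rule pam_u_finite[OF assms(3,4)])
    fix y
    have "0 \<le> \<bar>real_of_int y\<bar> * l / t" using assms by simp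
    then show "xi y \<le> max B (xi (int Z)) + \<bar>real_of_int y\<bar> * l / t"
      using B[of y] Z(2) by (cases "y = int Z \<or> y = - int Z") (auto simp: max_def)
  qed
  have "pam_U xi t = (\<integral>\<^sup>+ z. pam_u xi t z * indicator A z + pam_u xi t z * indicator (- A) z \<partial>count_space UNIV)"
    unfolding pam_U_def by (intro nn_integral_cong) (auto simp: indicator_def)
  also have "\<dots> = (\<integral>\<^sup>+ z. pam_u xi t z * indicator A z \<partial>count_space UNIV) + R"
    unfolding R_def by (rule nn_integral_add) auto
  also have "(\<integral>\<^sup>+ z. pam_u xi t z * indicator A z \<partial>count_space UNIV) = (\<Sum>z\<in>A. pam_u xi t z * indicator A z)"
    by (rule nn_integral_count_space') (auto simp: A_def)
  also have "\<dots> = W" unfolding W_def by (intro sum.cong) auto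
  finally have U: "pam_U xi t = W + R" .
  have Rle: "R \<le> ennreal (2 / (eta - 2)) * W + ennreal (exp (t * (B + eta + 2 * exp l)))"
    unfolding R_def W_def
    by (rule pam_mass_outside_le[where x = "xi (int Z)"]) (use assms in \<open>auto simp: A_def\<close>)
  have Wfin: "W < \<infinity>" using fin by (simp add: W_eq)
  have "t * (B + eta + 2 * exp l + c) \<le> t * (pam_Psi xi t (int Z) - real Z / t - 2)"
    using gap \<open>0 < t\<close> by (intro mult_left_mono) auto
  also have "\<dots> = t * xi (int Z) - real Z * ln (xi (int Z)) - real Z - 2 * t"
    using \<open>0 < t\<close> by (simp add: pam_Psi_def field_simps)
  finally have "ennreal (exp (t * (B + eta + 2 * exp l + c))) \<le> ennreal (exp (t * xi (int Z) - real Z * ln (xi (int Z)) - real Z - 2 * t))"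
    by (intro ennreal_leI) simp
  also have "\<dots> \<le> pam_u xi t (int Z)"
    using Z nonneg by (intro pam_u_lower_bound) auto
  also have "\<dots> \<le> W" by (simp add: W_eq)
  finally have Wge: "ennreal (exp (t * (B + eta + 2 * exp l + c))) \<le> W" .
  obtain w where w: "W = ennreal w" "0 \<le> w" using Wfin by (cases W) auto
  have wge: "exp (t * (B + eta + 2 * exp l + c)) \<le> w" using Wge w by simp
  then have w0: "0 < w" by (meson exp_gt_zero less_le_trans)
  have "exp (t * (B + eta + 2 * exp l)) = exp (- c * t) * exp (t * (B + eta + 2 * exp l + c))"
    by (simp add: exp_add[symmetric] algebra_simps)
  also have "\<dots> \<le> exp (- c * t) * w" using wge by simp
  finally have ele: "exp (t * (B + eta + 2 * exp l)) \<le> exp (- c * t) * w" .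
  have "R \<le> ennreal (2 / (eta - 2) * w + exp (t * (B + eta + 2 * exp l)))"
    using Rle w assms(2) by (simp add: ennreal_mult'[symmetric] ennreal_plus)
  also have "\<dots> \<le> ennreal ((2 / (eta - 2) + exp (- c * t)) * w)"
    using ele by (intro ennreal_leI) (simp add: distrib_right)
  finally have R2: "R \<le> ennreal ((2 / (eta - 2) + exp (- c * t)) * w)" .
  obtain q where q: "R = ennreal q" "0 \<le> q"
    using R2 by (cases R) (auto simp: top_unique)
  have q2: "q \<le> (2 / (eta - 2) + exp (- c * t)) * w"
    using R2 q w0 assms(2) by (simp add: ennreal_le_iff)
  have "enn2real (pam_u xi t (int Z)) + enn2real (pam_u xi t (- int Z)) = enn2real W"
    unfolding W_eq using fin by (simp add: enn2real_plus)
  moreover have "enn2real (pam_U xi t) = w + q" "enn2real W = w"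
    using U w q by (simp_all add: ennreal_plus[symmetric] del: ennreal_plus)
  moreover have "\<bar>w / (w + q) - 1\<bar> \<le> q / w"
  proof -
    have "w / (w + q) - 1 = - (q / (w + q))" using w0 q by (simp add: field_simps)
    moreover have "q / (w + q) \<le> q / w" using w0 q by (intro divide_left_mono) auto
    ultimately show ?thesis using w0 q by simp
  qed
  moreover have "q / w \<le> 2 / (eta - 2) + exp (- c * t)" using q2 w0 by (simp add: divide_le_eq)
  ultimately show ?thesis by simp
qed

section \<open>From a good potential to localisation\<close>

lemma pam_potential_int [simp]: "pam_potential x0 C (int n) = x0 (int n)"
  by (simp add: pam_potential_def)

lemma pam_potential_neg:
  "0 < n \<Longrightarrow> pam_potential x0 C (- int n) = (if C n = 1 then x0 (int n) else x0 (- int n))"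
  by (simp add: pam_potential_def)

text \<open>Here \<open>a\<close> is the height scale and \<open>r\<close> the distance scale of the relevant peaks. The choice
  \<open>exp l = a / ln t\<close> makes \<open>2 * exp l\<close> negligible against \<open>a\<close> while \<open>l\<close> agrees with \<open>ln (xi y)\<close>
  up to \<open>ln (ln t)\<close> for \<open>xi y\<close> of order \<open>a\<close>, so \<open>xi y - \<bar>y\<bar> * l / t\<close> may replace \<open>pam_Psi\<close>.\<close>

lemma pam_localisation_of_good_field:
  fixes x0 :: "int \<Rightarrow> real" and C :: "nat \<Rightarrow> real" and Z :: nat and t a r l h K K' \<delta> \<eta> :: real
  defines "xi \<equiv> pam_potential x0 C"
  assumes const: "0 < h" "h \<le> 1" "1 \<le> K" "1 \<le> K'" "0 < \<delta>" "\<delta> \<le> h / 8" "2 < \<eta>"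
    and t: "0 < t" and a: "0 < a" "ln t \<le> a" "ln a \<le> ln t" and r: "r = a * t / ln t"
    and l: "exp l = a / ln t"
    and lnt: "4 * K / h \<le> ln t"
    and gap: "\<eta> + 3 + (2 + K) * a / ln t + K * (ln K' + ln (ln t)) / ln t * a \<le> \<delta> * a"
    and ge1: "\<And>z. 1 \<le> x0 z"
    and ZD: "Z \<in> pam_D xi"
    and Zmax: "\<And>z. z \<in> pam_D xi \<Longrightarrow> pam_Psi xi t (int z) \<le> pam_Psi xi t (int Z)"
    and E1: "\<exists>y::nat. 1 \<le> y \<and> real y \<le> h / 2 * r \<and> h * a < x0 (int y)"
    and E2: "\<And>y. K * r < \<bar>real_of_int y\<bar> \<Longrightarrow> x0 y \<le> l / t * \<bar>real_of_int y\<bar>"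
    and E3: "\<And>y::nat. real y \<le> K * r \<Longrightarrow> x0 (int y) \<le> K' * a"
    and E4: "\<And>y y'::nat. real y \<le> K * r \<Longrightarrow> real y' \<le> K * r \<Longrightarrow> y \<noteq> y' \<Longrightarrow>
               h / 8 * a < x0 (int y) \<Longrightarrow> h / 8 * a < x0 (int y') \<Longrightarrow>
               \<delta> * a < \<bar>x0 (int y) - x0 (int y') - (real y - real y') * l / t\<bar>"
    and E5: "x0 0 < h / 4 * a"
    and E6: "\<And>y::nat. 1 \<le> y \<Longrightarrow> real y \<le> K * r \<Longrightarrow> C y \<noteq> 1 \<Longrightarrow>
               x0 (int y) \<le> h / 8 * a \<and> x0 (- int y) \<le> h / 8 * a"
  shows "\<bar>(enn2real (pam_u xi t (int Z)) + enn2real (pam_u xi t (- int Z))) / enn2real (pam_U xi t) - 1\<bar>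
           \<le> 2 / (\<eta> - 2) + exp (- t)"
proof -
  have "4 \<le> 4 * K / h" using const by (simp add: field_simps)
  then have L: "4 \<le> ln t" using lnt by linarith
  have r0: "0 < r" using r a t L by simp
  have rt: "r / t = a / ln t" using r t by simp
  have l_eq: "l = ln a - ln (ln t)"
  proof -
    have "l = ln (a / ln t)" using l by (metis ln_exp)
    then show ?thesis using a L by (simp add: ln_div)
  qed
  have "1 \<le> a / ln t" using a L by (simp add: le_divide_eq)
  then have l0: "0 \<le> l" using l by (metis one_le_exp_iff)
  have xi_nonneg: "1 \<le> xi z" for z
    using ge1 by (simp add: xi_def pam_potential_def)
  have xi_nat: "xi (int n) = x0 (int n)" for n by (simp add: xi_def)
  \<comment> \<open>\<open>\<omega> * a\<close> bounds how far \<open>pam_Psi\<close> can fall below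
    \<open>f\<close> at distances up to \<open>K * r\<close>, where
    \<open>ln (xi y) - l \<le> ln K' + ln (ln t)\<close> by \<open>E3\<close>.\<close>
  define \<omega> where "\<omega> = K * (ln K' + ln (ln t)) / ln t"
  have \<omega>0: "0 \<le> \<omega>" using const L by (simp add: \<omega>_def)
  have \<omega>_le: "\<omega> \<le> \<delta>"
  proof -
    have "0 \<le> \<eta> + 3 + (2 + K) * a / ln t" using const L a by simp
    then have "\<omega> * a \<le> \<delta> * a" using gap unfolding \<omega>_def by linarith
    then show ?thesis using a by simp
  qed
  define f where "f n = x0 (int n) - real n * l / t" for n
  have Psi_ge: "f y - \<omega> * a \<le> pam_Psi xi t (int y)" if "real y \<le> K * r" for y
  proof -
    have pos: "0 < x0 (int y)" using ge1[of "int y"] by linarith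
    have "ln (x0 (int y)) \<le> ln (K' * a)" using E3[OF that] pos by (intro ln_mono) auto
    also have "\<dots> = ln K' + ln a" using const a by (simp add: ln_mult)
    finally have le: "ln (x0 (int y)) - l \<le> ln K' + ln (ln t)" using l_eq by simp
    have "real y / t * (ln (x0 (int y)) - l) \<le> real y / t * (ln K' + ln (ln t))"
      using le t by (intro mult_left_mono) auto
    also have "\<dots> \<le> (K * r) / t * (ln K' + ln (ln t))"
      using that t const L by (intro mult_right_mono divide_right_mono) auto
    also have "(K * r) / t = K * (a / ln t)" using rt by (metis times_divide_eq_right)
    finally show ?thesis
      unfolding f_def pam_Psi_def xi_nat \<omega>_def by (simp add: algebra_simps)
  qed
  \<comment> \<open>The maximum is at least the value at the near high site of \<open>E1\<close>,
    which is duplicated by \<open>E6\<close>.\<close>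
  have PsiZ: "h / 4 * a \<le> pam_Psi xi t (int Z)"
  proof -
    obtain y :: nat where y: "1 \<le> y" "real y \<le> h / 2 * r" "h * a < x0 (int y)" using E1 by auto
    have "h / 2 * r \<le> K * r" using const r0 by (intro mult_right_mono) auto
    then have yK: "real y \<le> K * r" using y by linarith
    have "h / 8 * a \<le> h * a" using const a by simp
    then have "\<not> x0 (int y) \<le> h / 8 * a" using y(3) by linarith
    then have "C y = 1" using E6[OF y(1) yK] by blast
    then have D: "y \<in> pam_D xi"
      using y(1) unfolding pam_D_def xi_def by (simp add: pam_potential_neg)
    let ?x = "x0 (int y)"
    have xpos: "1 \<le> ?x" using ge1 by simp
    \<comment> \<open>A bound linear in \<open>?x\<close>: multiplied by \<open>real y / t\<close>,
      the logarithm costs at most \<open>h / 2 * a + ?x / 4\<close>.\<close>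
    have ln1: "ln ?x \<le> ln a + ?x / a"
    proof -
      have "ln (?x / a) \<le> ?x / a - 1" using xpos a by (intro ln_le_minus_one) auto
      then show ?thesis using xpos a by (simp add: ln_div)
    qed
    have yt: "real y / t \<le> h / 2 * (a / ln t)"
    proof -
      have "real y / t \<le> h / 2 * r / t" using y t by (intro divide_right_mono) auto
      then show ?thesis using rt by (metis times_divide_eq_right)
    qed
    have "real y / t * ln ?x \<le> h / 2 * (a / ln t) * (ln a + ?x / a)"
      using ln1 yt xpos t const a L by (intro mult_mono) (auto intro: order_trans[OF _ ln1])
    also have "\<dots> = h / 2 * a * (ln a / ln t) + h / 2 * ?x / ln t"
      using a L by (simp add: field_simps)
    also have "\<dots> \<le> h / 2 * a * 1 + 1 / 4 * ?x"
    proof (rule add_mono)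
      show "h / 2 * a * (ln a / ln t) \<le> h / 2 * a * 1"
        using const a L by (intro mult_left_mono) (auto simp: divide_le_eq)
      have "h / 2 / ln t \<le> 1 / 4" using const L by (simp add: divide_le_eq)
      then have "h / 2 / ln t * ?x \<le> 1 / 4 * ?x" using xpos by (intro mult_right_mono) auto
      then show "h / 2 * ?x / ln t \<le> 1 / 4 * ?x" by simp
    qed
    finally have "pam_Psi xi t (int y) \<ge> ?x - (h / 2 * a + 1 / 4 * ?x)"
      unfolding pam_Psi_def xi_nat by simp
    then have "h / 4 * a \<le> pam_Psi xi t (int y)" using y(3) by linarith
    then show ?thesis using Zmax[OF D] by linarith
  qed
  let ?P = "pam_Psi xi t (int Z)"
  have xZ: "h / 4 * a \<le> x0 (int Z)"
  proof -
    have "0 \<le> real_of_int \<bar>int Z\<bar> / t * ln (xi (int Z))" using t xi_nonneg[of "int Z"] by simp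
    then show ?thesis using PsiZ unfolding pam_Psi_def xi_nat by linarith
  qed
  \<comment> \<open>Since \<open>ln t \<ge> 4 / h\<close>, the height of \<open>Z\<close>, at least
    \<open>h / 4 * a\<close>, is at least \<open>exp l\<close>; so the slope \<open>l\<close>
    underestimates the logarithm there.\<close>
  have PsiZ_le: "?P \<le> f Z"
  proof -
    have "1 / ln t \<le> h / 4" 
    proof -
      have "4 / h \<le> 4 * K / h" using const by (intro divide_right_mono) auto
      then have "4 / h \<le> ln t" using lnt by linarith
      then show ?thesis using const L by (simp add: field_simps)
    qed
    then have "a * (1 / ln t) \<le> a * (h / 4)" using a by (intro mult_left_mono) auto
    moreover have "exp l = a * (1 / ln t)" using l by simp
    ultimately have "exp l \<le> x0 (int Z)" using xZ by (metis mult.commute order_trans)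
    then have "l \<le> ln (x0 (int Z))" using ge1[of "int Z"] by (subst ln_ge_iff) auto
    then have "real Z / t * l \<le> real Z / t * ln (x0 (int Z))" using t by (intro mult_left_mono) auto
    then show ?thesis unfolding f_def pam_Psi_def xi_nat by simp
  qed
  have ha: "0 < h / 4 * a" using const a by simp
  \<comment> \<open>By \<open>E5\<close> the maximiser is not the origin, and by \<open>E2\<close>,
    which makes \<open>f\<close> nonpositive far out, it is not beyond \<open>K * r\<close>.\<close>
  have Z0: "0 < Z"
  proof (rule ccontr)
    assume "\<not> 0 < Z"
    then have "?P = x0 0" using xi_nat[of 0] by (simp add: pam_Psi_def)
    then show False using PsiZ E5 by simp
  qed
  have ZK: "real Z \<le> K * r"
  proof (rule ccontr)
    assume "\<not> real Z \<le> K * r"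
    then have "x0 (int Z) \<le> l / t * real Z" using E2[of "int Z"] by simp
    then have "f Z \<le> 0" by (simp add: f_def mult.commute)
    then show False using PsiZ PsiZ_le ha by linarith
  qed
  have Zt: "real Z / t \<le> K * a / ln t"
  proof -
    have "real Z / t \<le> K * r / t" using ZK t by (intro divide_right_mono) auto
    then show ?thesis using rt by (metis times_divide_eq_right)
  qed
  \<comment> \<open>Of the separation \<open>\<delta> * a\<close> between values of
    \<open>f\<close>, the part \<open>\<omega> * a\<close> is spent on comparing \<open>f\<close>
    with \<open>pam_Psi\<close>.\<close>
  define B where "B = ?P - (\<delta> - \<omega>) * a"
  have \<delta>\<omega>: "(\<delta> - \<omega>) * a \<le> h / 8 * a" using \<omega>0 const a by (intro mult_right_mono) auto
  have D_bound: "f n \<le> B" if n: "n \<in> pam_D xi" "n \<noteq> Z" "real n \<le> K * r" for n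
  proof (cases "x0 (int n) \<le> h / 8 * a")
    case True
    have "0 \<le> real n * l / t" using l0 t by simp
    then show ?thesis using True PsiZ \<delta>\<omega> unfolding B_def f_def by linarith
  next
    case False
    have "h / 8 * a < x0 (int Z)" using xZ ha by linarith
    then have "\<delta> * a < \<bar>x0 (int n) - x0 (int Z) - (real n - real Z) * l / t\<bar>"
      using False n ZK by (intro E4) auto
    also have "x0 (int n) - x0 (int Z) - (real n - real Z) * l / t = f n - f Z"
      by (simp add: f_def diff_divide_distrib left_diff_distrib)
    finally have far: "\<delta> * a < \<bar>f n - f Z\<bar>" .
    \<comment> \<open>A duplicated site ahead of \<open>Z\<close> in \<open>f\<close> by more than
      \<open>\<delta> * a\<close> would also beat \<open>Z\<close> in \<open>pam_Psi\<close>,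
      because \<open>\<omega> \<le> \<delta>\<close>.\<close>
    have "\<not> \<delta> * a < f n - f Z"
    proof
      assume *: "\<delta> * a < f n - f Z"
      have "\<omega> * a \<le> \<delta> * a" using \<omega>_le a by (intro mult_right_mono) auto
      then show False using * Psi_ge[OF n(3)] Zmax[OF n(1)] PsiZ_le by linarith
    qed
    then have "f n < f Z - \<delta> * a" using far by linarith
    then show ?thesis using Psi_ge[OF ZK] unfolding B_def by (simp add: left_diff_distrib)
  qed
  \<comment> \<open>Far sites are covered by \<open>E2\<close>, near duplicated sites by
    \<open>D_bound\<close>, and the other near sites are low by \<open>E6\<close>.\<close>
  have B: "xi y \<le> B + \<bar>real_of_int y\<bar> * l / t" if y: "y \<noteq> int Z" "y \<noteq> - int Z" for y
  proof -
    define n where "n = nat \<bar>y\<bar>"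
    have n: "y = int n \<or> y = - int n" "\<bar>real_of_int y\<bar> = real n" "n \<noteq> Z"
      using y unfolding n_def by auto
    have nonneg: "0 \<le> real n * l / t" using l0 t by simp
    have xi_cases: "xi y = x0 (int n) \<or> xi y = x0 (- int n)"
      using n(1) unfolding xi_def pam_potential_def by auto
    show ?thesis
    proof (cases "real n \<le> K * r")
      case False
      then have "x0 (int n) \<le> l / t * real n" "x0 (- int n) \<le> l / t * real n"
        using E2[of "int n"] E2[of "- int n"] by auto
      then have "xi y \<le> real n * l / t" using xi_cases by (auto simp: mult.commute)
      then show ?thesis using PsiZ \<delta>\<omega> ha unfolding B_def n(2) by linarith
    next
      case True
      show ?thesis
      proof (cases "n \<in> pam_D xi")
        case D: True
        then have "xi y = x0 (int n)" using n(1) xi_nat[of n] unfolding pam_D_def by auto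
        then show ?thesis using D_bound[OF D n(3) True] unfolding f_def n(2) by simp
      next
        case False
        have "n \<noteq> 0"
        proof
          assume "n = 0"
          then show False using False by (simp add: pam_D_def)
        qed
        moreover from this False have "C n \<noteq> 1"
          unfolding pam_D_def xi_def by (auto simp: pam_potential_neg)
        ultimately have "x0 (int n) \<le> h / 8 * a \<and> x0 (- int n) \<le> h / 8 * a"
          using True by (intro E6) auto
        then have "xi y \<le> h / 8 * a" using xi_cases by auto
        then show ?thesis using PsiZ \<delta>\<omega> nonneg unfolding B_def n(2) by linarith
      qed
    qed
  qed
  have "real Z \<le> t * xi (int Z)"
  proof -
    have "K / ln t \<le> h / 4" using lnt const L by (simp add: field_simps)
    then have "K / ln t * a \<le> h / 4 * a" using a by (intro mult_right_mono) auto
    moreover have "K / ln t * a = K * a / ln t" by simp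
    ultimately have "real Z / t \<le> x0 (int Z)" using Zt xZ by linarith
    then show ?thesis using t by (simp add: xi_nat field_simps)
  qed
  \<comment> \<open>The constant \<open>3\<close> in \<open>gap\<close> consists of the
    \<open>2\<close> from the jump rates and the surplus \<open>c = 1\<close>.\<close>
  moreover have "B + \<eta> + 2 * exp l + 1 \<le> ?P - real Z / t - 2"
  proof -
    have "2 * exp l + real Z / t \<le> (2 + K) * a / ln t"
      using l Zt by (simp add: distrib_right add_divide_distrib)
    then show ?thesis using gap unfolding B_def \<omega>_def by (simp add: left_diff_distrib)
  qed
  moreover have "xi (int Z) = xi (- int Z)" using ZD by (simp add: pam_D_def)
  ultimately have "\<bar>(enn2real (pam_u xi t (int Z)) + enn2real (pam_u xi t (- int Z))) / enn2real (pam_U xi t) - 1\<bar>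
           \<le> 2 / (\<eta> - 2) + exp (- 1 * t)"
    using B xi_nonneg const t l0 Z0
    by (intro pam_localisation[where l = l and B = B])
       (auto intro: order_trans[OF zero_le_one] less_le_trans[OF zero_less_one])
  then show ?thesis by simp
qed

section \<open>Bounds for the Pareto field\<close>

text \<open>Scaling out \<open>w\<close> leaves
  \<open>1 - (1 + d / w) powr (- \<alpha>) \<le> \<alpha> * (d / w)\<close>, which follows from
  \<open>ln (1 + u) \<le> u\<close> and \<open>1 + v \<le> exp v\<close>.\<close>

lemma powr_minus_diff_le:
  fixes w d \<alpha> :: real
  assumes "0 < w" "0 \<le> d" "0 \<le> \<alpha>"
  shows "w powr (- \<alpha>) - (w + d) powr (- \<alpha>) \<le> d * \<alpha> * w powr (- \<alpha> - 1)"
proof -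
  let ?u = "d / w"
  have u: "0 \<le> ?u" using assms by simp
  have "1 - \<alpha> * ?u \<le> 1 - \<alpha> * ln (1 + ?u)"
    using mult_left_mono[OF ln_add_one_self_le_self[OF u] assms(3)] by simp
  also have "\<dots> \<le> exp (- \<alpha> * ln (1 + ?u))"
    using exp_ge_add_one_self[of "- \<alpha> * ln (1 + ?u)"] by simp
  also have "\<dots> = (1 + ?u) powr (- \<alpha>)"
    using u by (simp add: powr_def)
  finally have 1: "1 - (1 + ?u) powr (- \<alpha>) \<le> \<alpha> * ?u" by simp
  have "w + d = w * (1 + ?u)" using assms by (simp add: field_simps)
  then have "(w + d) powr (- \<alpha>) = w powr (- \<alpha>) * (1 + ?u) powr (- \<alpha>)"
    using assms u by (simp add: powr_mult)
  then have "w powr (- \<alpha>) - (w + d) powr (- \<alpha>) = w powr (- \<alpha>) * (1 - (1 + ?u) powr (- \<alpha>))"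
    by (simp add: algebra_simps)
  also have "\<dots> \<le> w powr (- \<alpha>) * (\<alpha> * ?u)"
    using 1 by (intro mult_left_mono) auto
  also have "\<dots> = d * \<alpha> * w powr (- \<alpha> - 1)"
    using assms by (simp add: powr_diff)
  finally show ?thesis .
qed

text \<open>\<open>Inl\<close> indexes the values of the field and \<open>Inr\<close> the coins;
  \<open>C n = 1\<close> makes the value at \<open>- n\<close> a copy of that at \<open>n\<close>,
  so the coins start at \<open>n = 1\<close>.\<close>

locale duplicated_pareto = prob_space M for M :: "'a measure" +
  fixes \<alpha> :: real and p :: "nat \<Rightarrow> real"
    and xi0 :: "int \<Rightarrow> 'a \<Rightarrow> real" and C :: "nat \<Rightarrow> 'a \<Rightarrow> real"
  assumes alpha: "2 \<le> \<alpha>"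
    and p_lim: "p \<longlonglongrightarrow> 1"
    and indep: "indep_vars (\<lambda>_. borel) (\<lambda>i. case i of Inl z \<Rightarrow> xi0 z | Inr n \<Rightarrow> C n)
                  (range Inl \<union> Inr ` {1..})"
    and pareto: "1 \<le> x \<Longrightarrow> prob {\<omega> \<in> space M. x < xi0 z \<omega>} = x powr (- \<alpha>)"
    and copy: "1 \<le> n \<Longrightarrow> prob {\<omega> \<in> space M. C n \<omega> = 1} = p n"
begin

lemma xi0_measurable [measurable]: "xi0 z \<in> borel_measurable M"
  using indep unfolding indep_vars_def2 by (auto dest!: bspec[where x = "Inl z"])

lemma C_measurable: "1 \<le> n \<Longrightarrow> C n \<in> borel_measurable M"
  using indep unfolding indep_vars_def2 by (auto dest!: bspec[where x = "Inr n"])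

lemma indep_var_pair:
  fixes i j :: "int + nat"
  assumes "i \<noteq> j" "i \<in> range Inl \<union> Inr ` {1..}" "j \<in> range Inl \<union> Inr ` {1..}"
  shows "indep_var borel (case i of Inl z \<Rightarrow> xi0 z | Inr n \<Rightarrow> C n)
                   borel (case j of Inl z \<Rightarrow> xi0 z | Inr n \<Rightarrow> C n)"
proof -
  have "indep_vars (\<lambda>_. borel) (\<lambda>i. case i of Inl z \<Rightarrow> xi0 z | Inr n \<Rightarrow> C n) (insert i {j})"
    using assms by (intro indep_vars_subset[OF indep]) auto
  \<comment> \<open>Over a single index the minimum is the variable itself.\<close>
  from indep_vars_Min[OF _ _ this] assms show ?thesis by simp
qed

lemma indep_var_xi0: "y \<noteq> y' \<Longrightarrow> indep_var borel (xi0 y) borel (xi0 y')"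
  using indep_var_pair[of "Inl y" "Inl y'"] by simp

lemma indep_var_C_xi0: "1 \<le> n \<Longrightarrow> indep_var borel (C n) borel (xi0 y)"
  using indep_var_pair[of "Inr n" "Inl y"] by auto

lemma prob_xi0_gt_le:
  assumes "0 < x"
  shows "prob {\<omega> \<in> space M. x < xi0 z \<omega>} \<le> x powr (- \<alpha>)"
proof (cases "1 \<le> x")
  case False
  then have "x powr (- \<alpha>) \<ge> x powr 0"
    using assms alpha by (intro powr_mono') auto
  then show ?thesis using assms by (intro order_trans[OF prob_le_1]) simp
qed (simp add: pareto)

lemma AE_xi0_ge_1: "AE \<omega> in M. \<forall>z. 1 \<le> xi0 z \<omega>"
proof (subst AE_all_countable, rule allI)
  fix z
  have "prob {\<omega> \<in> space M. 1 < xi0 z \<omega>} = 1" using pareto[of 1 z] by simp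
  then have "AE \<omega> in M. 1 < xi0 z \<omega>"
    by (subst (asm) prob_Collect_eq_1) auto
  then show "AE \<omega> in M. 1 \<le> xi0 z \<omega>" by eventually_elim simp
qed

lemma prob_xi0_between_le:
  assumes "1 \<le> w" "0 \<le> d"
  shows "prob {\<omega> \<in> space M. w < xi0 z \<omega> \<and> xi0 z \<omega> \<le> w + d} \<le> d * \<alpha> * w powr (- \<alpha> - 1)"
proof -
  have "{\<omega> \<in> space M. w < xi0 z \<omega> \<and> xi0 z \<omega> \<le> w + d}
      = {\<omega> \<in> space M. w < xi0 z \<omega>} - {\<omega> \<in> space M. w + d < xi0 z \<omega>}" by auto
  also have "prob \<dots> = w powr (- \<alpha>) - (w + d) powr (- \<alpha>)"
    using assms by (subst finite_measure_Diff) (auto simp: pareto)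
  also have "\<dots> \<le> d * \<alpha> * w powr (- \<alpha> - 1)"
    using assms alpha by (intro powr_minus_diff_le) auto
  finally show ?thesis .
qed

text \<open>Given \<open>xi0 y\<close>, the value \<open>xi0 y'\<close> is confined to an interval
  of length \<open>2 * d\<close> above \<open>x\<close>, where the Pareto density is at most
  \<open>\<alpha> * x powr (- \<alpha> - 1)\<close>. Integrating over \<open>xi0 y > x\<close> gives
  the last factor.\<close>

lemma prob_close_pair_le:
  assumes "y \<noteq> y'" "1 \<le> x" "0 < d"
  shows "prob {\<omega> \<in> space M. x < xi0 y \<omega> \<and> x < xi0 y' \<omega> \<and> \<bar>xi0 y \<omega> - xi0 y' \<omega> - c\<bar> \<le> d}
           \<le> 3 * d * \<alpha> * x powr (- \<alpha> - 1) * x powr (- \<alpha>)"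
proof -
  define N where "N = distr M borel (xi0 y)"
  define N' where "N' = distr M borel (xi0 y')"
  interpret N: prob_space N unfolding N_def by (rule prob_space_distr) simp
  interpret N': prob_space N' unfolding N'_def by (rule prob_space_distr) simp
  have eq: "N \<Otimes>\<^sub>M N' = distr M (borel \<Otimes>\<^sub>M borel) (\<lambda>\<omega>. (xi0 y \<omega>, xi0 y' \<omega>))"
    using indep_var_xi0[OF assms(1)] unfolding indep_var_distribution_eq N_def N'_def by simp
  define S :: "(real \<times> real) set" where "S = {(u, v). x < u \<and> x < v \<and> \<bar>u - v - c\<bar> \<le> d}"
  have S: "S \<in> sets (borel \<Otimes>\<^sub>M borel)"
  proof -
    have "{z \<in> space (borel \<Otimes>\<^sub>M borel). x < fst z \<and> x < snd z \<and> \<bar>fst z - snd z - c\<bar> \<le> d}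
       \<in> sets (borel \<Otimes>\<^sub>M (borel :: real measure))" by measurable
    then show ?thesis by (simp add: S_def case_prod_beta' space_pair_measure)
  qed
  define q where "q = 3 * d * \<alpha> * x powr (- \<alpha> - 1)"
  have q0: "0 \<le> q" using assms alpha by (simp add: q_def)
  have slice: "emeasure N' (Pair u -` S) \<le> ennreal q * indicator {x<..} u" for u
  proof (cases "x < u")
    case True
    \<comment> \<open>Making the interval open on the left costs a further \<open>d\<close>, hence
      the shift \<open>2 * d\<close> and the length \<open>3 * d\<close>.\<close>
    define w where "w = max x (u - c - 2 * d)"
    have w: "1 \<le> w" "x \<le> w" using assms by (auto simp: w_def)
    have "Pair u -` S \<subseteq> {w<..w + 3 * d}"
    proof
      fix v assume "v \<in> Pair u -` S"
      then have "x < v" "\<bar>u - v - c\<bar> \<le> d" by (auto simp: S_def)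
      then show "v \<in> {w<..w + 3 * d}" using assms(3) by (auto simp: w_def)
    qed
    then have "emeasure N' (Pair u -` S) \<le> emeasure N' {w<..w + 3 * d}"
      by (intro emeasure_mono) (auto simp: N'_def)
    also have "\<dots> = ennreal (prob {\<omega> \<in> space M. w < xi0 y' \<omega> \<and> xi0 y' \<omega> \<le> w + 3 * d})"
    proof -
      have "xi0 y' -` {w<..w + 3 * d} \<inter> space M = {\<omega> \<in> space M. w < xi0 y' \<omega> \<and> xi0 y' \<omega> \<le> w + 3 * d}"
        by auto
      then show ?thesis unfolding N'_def by (simp add: emeasure_distr emeasure_eq_measure)
    qed
    also have "\<dots> \<le> ennreal q"
    proof (rule ennreal_leI)
      have "prob {\<omega> \<in> space M. w < xi0 y' \<omega> \<and> xi0 y' \<omega> \<le> w + 3 * d} \<le> 3 * d * \<alpha> * w powr (- \<alpha> - 1)"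
        using w assms by (intro prob_xi0_between_le) auto
      also have "\<dots> \<le> q" unfolding q_def
        using w assms alpha by (intro mult_left_mono powr_mono2') auto
      finally show "prob {\<omega> \<in> space M. w < xi0 y' \<omega> \<and> xi0 y' \<omega> \<le> w + 3 * d} \<le> q" .
    qed
    finally show ?thesis using True by simp
  qed (simp add: S_def)
  have "emeasure M {\<omega> \<in> space M. x < xi0 y \<omega> \<and> x < xi0 y' \<omega> \<and> \<bar>xi0 y \<omega> - xi0 y' \<omega> - c\<bar> \<le> d}
      = emeasure (N \<Otimes>\<^sub>M N') S"
    unfolding eq by (subst emeasure_distr) (auto simp: S, auto simp: S_def intro!: arg_cong[where f = "emeasure M"])
  also have "\<dots> = (\<integral>\<^sup>+ u. emeasure N' (Pair u -` S) \<partial>N)"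
    by (rule N'.emeasure_pair_measure_alt) (use S in \<open>simp add: N_def N'_def cong: sets_pair_measure_cong\<close>)
  also have "\<dots> \<le> (\<integral>\<^sup>+ u. ennreal q * indicator {x<..} u \<partial>N)"
    by (intro nn_integral_mono slice)
  also have "\<dots> = ennreal q * emeasure N {x<..}"
    by (rule nn_integral_cmult_indicator) (simp add: N_def)
  also have "emeasure N {x<..} = ennreal (x powr (- \<alpha>))"
  proof -
    have "xi0 y -` {x<..} \<inter> space M = {\<omega> \<in> space M. x < xi0 y \<omega>}" by auto
    then show ?thesis unfolding N_def using assms by (simp add: emeasure_distr emeasure_eq_measure pareto)
  qed
  finally show ?thesis
    using q0 by (simp add: emeasure_eq_measure ennreal_mult'[symmetric] q_def)
qed

lemma prob_all_le_le:
  assumes "1 \<le> x"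
  shows "prob {\<omega> \<in> space M. \<forall>y\<in>{1..N::nat}. xi0 (int y) \<omega> \<le> x} \<le> exp (- (real N * x powr (- \<alpha>)))"
proof (cases "N = 0")
  case False
  let ?X = "\<lambda>i. case i of Inl z \<Rightarrow> xi0 z | Inr n \<Rightarrow> C n"
  let ?J = "(\<lambda>y. Inl (int y)) ` {1..N} :: (int + nat) set"
  have le: "x powr (- \<alpha>) \<le> 1" using assms alpha powr_mono[of "- \<alpha>" 0 x] by simp
  have one: "prob (xi0 y -` {..x} \<inter> space M) = 1 - x powr (- \<alpha>)" for y
  proof -
    have "xi0 y -` {..x} \<inter> space M = space M - {\<omega> \<in> space M. x < xi0 y \<omega>}" by auto
    then show ?thesis using assms by (simp add: prob_compl pareto)
  qed
  have "{\<omega> \<in> space M. \<forall>y\<in>{1..N}. xi0 (int y) \<omega> \<le> x} = (\<Inter>i\<in>?J. ?X i -` {..x} \<inter> space M)"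
    using False by auto
  also have "prob \<dots> = (\<Prod>i\<in>?J. prob (?X i -` {..x} \<inter> space M))"
    using False by (intro indep_varsD[OF indep]) auto
  also have "\<dots> = (1 - x powr (- \<alpha>)) ^ N"
    by (subst prod.reindex) (auto simp: inj_on_def one)
  also have "\<dots> \<le> exp (- (x powr (- \<alpha>))) ^ N"
    using le exp_ge_add_one_self[of "- (x powr (- \<alpha>))"] by (intro power_mono) auto
  also have "\<dots> = exp (- (real N * x powr (- \<alpha>)))"
    by (simp add: exp_of_nat_mult[symmetric])
  finally show ?thesis .
qed simp

text \<open>A union bound. As \<open>\<alpha> \<ge> 2\<close>, the tail at distance \<open>n\<close>
  is at most a multiple of \<open>X powr (2 - \<alpha>) / n ^ 2\<close>, and
  \<open>1 / n ^ 2 \<le> 1 / (n - 1) - 1 / n\<close> telescopes. The two signs and rounding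
  \<open>X\<close> down cost a factor \<open>2\<close> each.\<close>

lemma prob_far_peak_le:
  assumes "0 < c" "1 \<le> X"
  shows "{\<omega> \<in> space M. \<exists>y. X < \<bar>real_of_int y\<bar> \<and> c * \<bar>real_of_int y\<bar> < xi0 y \<omega>} \<in> events"
    and "prob {\<omega> \<in> space M. \<exists>y. X < \<bar>real_of_int y\<bar> \<and> c * \<bar>real_of_int y\<bar> < xi0 y \<omega>}
           \<le> 4 * c powr (- \<alpha>) * X powr (1 - \<alpha>)"
proof -
  let ?E = "{\<omega> \<in> space M. \<exists>y. X < \<bar>real_of_int y\<bar> \<and> c * \<bar>real_of_int y\<bar> < xi0 y \<omega>}"
  show E: "?E \<in> events" by measurable
  define m where "m = nat \<lfloor>X\<rfloor>"
  have "1 \<le> \<lfloor>X\<rfloor>" using assms(2) by simp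
  then have m: "1 \<le> real m" "real m \<le> X" "X < real m + 1" unfolding m_def by linarith+
  define F where "F k = {\<omega> \<in> space M. c * (real m + 1 + real k) < xi0 (int (m + 1 + k)) \<omega>}
      \<union> {\<omega> \<in> space M. c * (real m + 1 + real k) < xi0 (- int (m + 1 + k)) \<omega>}" for k
  have F: "F k \<in> events" for k unfolding F_def by measurable
  have sub: "?E \<subseteq> (\<Union>k. F k)"
  proof
    fix \<omega> assume "\<omega> \<in> ?E"
    then obtain y where \<omega>: "\<omega> \<in> space M" and y: "X < \<bar>real_of_int y\<bar>" "c * \<bar>real_of_int y\<bar> < xi0 y \<omega>" by auto
    define k where "k = nat (\<bar>y\<bar> - int m - 1)"
    have "int m < \<bar>y\<bar>" using y(1) m(2) by linarith
    then have k: "\<bar>y\<bar> = int (m + 1 + k)" by (simp add: k_def)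
    then have ry: "\<bar>real_of_int y\<bar> = real m + 1 + real k"
      by (metis of_int_abs of_int_of_nat_eq of_nat_1 of_nat_add)
    have "y = int (m + 1 + k) \<or> y = - int (m + 1 + k)" using k by linarith
    then have "\<omega> \<in> F k" using \<omega> y(2) unfolding F_def ry by auto
    then show "\<omega> \<in> (\<Union>k. F k)" by auto
  qed
  define B where "B = 2 * c powr (- \<alpha>) * X powr (2 - \<alpha>)"
  have B0: "0 \<le> B" by (simp add: B_def)
  define g where "g k = 1 / (real m + real k)" for k
  have "g \<longlonglongrightarrow> 0" unfolding g_def by real_asymp
  then have "(\<lambda>k. g k - g (Suc k)) sums (g 0 - 0)" by (rule telescope_sums')
  then have gs: "(\<lambda>k. B * (g k - g (Suc k))) sums (B * (1 / real m))"
    by (intro sums_mult) (simp add: g_def)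
  have Fk: "prob (F k) \<le> B * (g k - g (Suc k))" for k
  proof -
    let ?n = "real m + 1 + real k"
    have n: "X \<le> ?n" "0 < ?n" using m by auto
    have "prob (F k) \<le> (c * ?n) powr (- \<alpha>) + (c * ?n) powr (- \<alpha>)"
      unfolding F_def using assms n
      by (intro order_trans[OF measure_Un_le] add_mono prob_xi0_gt_le) auto
    also have "\<dots> = 2 * c powr (- \<alpha>) * ?n powr (- \<alpha>)"
      using assms n by (simp add: powr_mult)
    also have "?n powr (- \<alpha>) = ?n powr (2 - \<alpha>) * ?n powr (- 2)"
      by (simp add: powr_add[symmetric])
    also have "\<dots> \<le> X powr (2 - \<alpha>) * (g k - g (Suc k))"
    proof (rule mult_mono)
      show "?n powr (2 - \<alpha>) \<le> X powr (2 - \<alpha>)"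
        using n assms alpha by (intro powr_mono2') auto
      have "?n powr (- 2) = 1 / (?n * ?n)"
        using n by (simp add: powr_minus powr_numeral power2_eq_square inverse_eq_divide)
      also have "\<dots> \<le> 1 / ((real m + real k) * ?n)"
        using m n by (intro divide_left_mono mult_right_mono mult_pos_pos) auto
      also have "\<dots> = g k - g (Suc k)"
        unfolding g_def using m by (simp add: field_simps)
      finally show "?n powr (- 2) \<le> g k - g (Suc k)" .
    qed auto
    finally show ?thesis unfolding B_def by (simp add: mult_left_mono mult.assoc)
  qed
  have sumF: "summable (\<lambda>k. prob (F k))"
    by (rule summable_comparison_test'[OF sums_summable[OF gs], of 0]) (use Fk in auto)
  have "prob ?E \<le> prob (\<Union>k. F k)"
    using sub F by (intro finite_measure_mono) auto
  also have "\<dots> \<le> (\<Sum>k. prob (F k))"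
    using F sumF by (intro finite_measure_subadditive_countably) auto
  also have "\<dots> \<le> (\<Sum>k. B * (g k - g (Suc k)))"
    by (intro suminf_le Fk sumF sums_summable[OF gs])
  also have "\<dots> = B * (1 / real m)" using gs by (simp add: sums_iff)
  also have "\<dots> \<le> B * (2 / X)"
  proof (rule mult_left_mono[OF _ B0])
    have "X \<le> 2 * real m" using m by linarith
    then show "1 / real m \<le> 2 / X" using divide_left_mono[of X "2 * real m" 2] m assms by simp
  qed
  also have "\<dots> = 4 * c powr (- \<alpha>) * X powr (1 - \<alpha>)"
  proof -
    have "X powr (2 - \<alpha>) / X = X powr (1 - \<alpha>)"
      using assms powr_diff[of X "2 - \<alpha>" 1] by simp
    moreover have "B * (2 / X) = 4 * c powr (- \<alpha>) * (X powr (2 - \<alpha>) / X)" by (simp add: B_def)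
    ultimately show ?thesis by (simp only:)
  qed
  finally show "prob ?E \<le> 4 * c powr (- \<alpha>) * X powr (1 - \<alpha>)" .
qed


section \<open>Probabilities of the bad events on the peak scale\<close>

lemma prob_no_near_peak_le:
  assumes "0 < h" "h \<le> 1" "1 \<le> h * a" "4 / h \<le> a powr \<alpha>"
  shows "prob {\<omega> \<in> space M. \<forall>y\<in>{1..nat \<lfloor>h / 2 * a powr \<alpha>\<rfloor>}. xi0 (int y) \<omega> \<le> h * a} \<le> 4 * h"
proof -
  define r where "r = a powr \<alpha>"
  define N where "N = nat \<lfloor>h / 2 * r\<rfloor>"
  have a0: "0 < a" using assms by (metis less_le_trans zero_less_mult_pos zero_less_one)
  have r0: "0 < r" using a0 by (simp add: r_def)
  have "4 \<le> h * r" using assms unfolding r_def by (simp add: field_simps)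
  moreover have "h / 2 * r - 1 \<le> real N" unfolding N_def by linarith
  ultimately have N: "h / 4 * r \<le> real N" by linarith
  \<comment> \<open>As \<open>h \<le> 1\<close> and \<open>\<alpha> \<ge> 2\<close>, the expected
    number of sites above \<open>h * a\<close> is at least \<open>1 / (4 * h)\<close>, which is
    large for small \<open>h\<close>.\<close>
  have "1 / (4 * h) = h / 4 * h powr (- 2)"
    using assms by (simp add: powr_minus powr_numeral power2_eq_square field_simps)
  also have "\<dots> \<le> h / 4 * h powr (- \<alpha>)"
    using assms alpha by (intro mult_left_mono powr_mono') auto
  also have "\<dots> = h / 4 * r * (h * a) powr (- \<alpha>)"
    using assms a0 by (simp add: r_def powr_mult powr_minus field_simps)
  also have "\<dots> \<le> real N * (h * a) powr (- \<alpha>)"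
    using N by (intro mult_right_mono) auto
  finally have ge: "1 / (4 * h) \<le> real N * (h * a) powr (- \<alpha>)" .
  have "prob {\<omega> \<in> space M. \<forall>y\<in>{1..N}. xi0 (int y) \<omega> \<le> h * a} \<le> exp (- (real N * (h * a) powr (- \<alpha>)))"
    using assms by (intro prob_all_le_le)
  also have "\<dots> \<le> exp (- (1 / (4 * h)))" using ge by simp
  also have "\<dots> \<le> 1 / (1 / (4 * h))"
  proof -
    have "1 / (4 * h) \<le> exp (1 / (4 * h))" using exp_ge_add_one_self[of "1 / (4 * h)"] by linarith
    then have "inverse (exp (1 / (4 * h))) \<le> inverse (1 / (4 * h))"
      using assms by (intro le_imp_inverse_le) auto
    then show ?thesis by (simp add: exp_minus)
  qed
  finally show ?thesis unfolding N_def r_def by simp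
qed

text \<open>From \<open>t / ln t = a powr (\<alpha> - 1)\<close> the slope \<open>l / t\<close> is
  at least \<open>1 / (2 * \<alpha> * a powr (\<alpha> - 1))\<close>. In the bound for far peaks all
  powers of \<open>a\<close> then cancel and \<open>K powr (1 - \<alpha>)\<close> remains.\<close>

lemma prob_far_peak_scaled_le:
  assumes "0 < a" "1 < t" "1 \<le> K" "1 \<le> a powr \<alpha>" "a powr \<alpha> = a * t / ln t" "ln t / (2 * \<alpha>) \<le> l"
  shows "prob {\<omega> \<in> space M. \<exists>y. K * a powr \<alpha> < \<bar>real_of_int y\<bar> \<and> l / t * \<bar>real_of_int y\<bar> < xi0 y \<omega>}
           \<le> 4 * (2 * \<alpha>) powr \<alpha> / K"
proof -
  have L: "0 < ln t" using assms by simp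
  have l0: "0 < l" using L alpha assms(6) by (meson divide_pos_pos less_le_trans mult_pos_pos zero_less_numeral)
  have tl: "t / ln t = a powr (\<alpha> - 1)"
  proof -
    have "a powr (\<alpha> - 1) = a powr \<alpha> / a" using assms by (simp add: powr_diff)
    then show ?thesis using assms by simp
  qed
  have K1: "1 \<le> K * a powr \<alpha>" using assms by (metis mult_mono mult_1 zero_le_one order_trans)
  have "prob {\<omega> \<in> space M. \<exists>y. K * a powr \<alpha> < \<bar>real_of_int y\<bar> \<and> l / t * \<bar>real_of_int y\<bar> < xi0 y \<omega>}
     \<le> 4 * (l / t) powr (- \<alpha>) * (K * a powr \<alpha>) powr (1 - \<alpha>)"
    using K1 l0 assms by (intro prob_far_peak_le) auto
  also have "\<dots> \<le> 4 * ((2 * \<alpha>) powr \<alpha> * a powr (\<alpha> * (\<alpha> - 1))) * (K * a powr \<alpha>) powr (1 - \<alpha>)"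
  proof (intro mult_right_mono mult_left_mono)
    have "(l / t) powr (- \<alpha>) \<le> (1 / (2 * \<alpha>) / (t / ln t)) powr (- \<alpha>)"
    proof (rule powr_mono2')
      have "ln t / (2 * \<alpha>) / t \<le> l / t" using assms by (intro divide_right_mono) auto
      then show "1 / (2 * \<alpha>) / (t / ln t) \<le> l / t" by (simp add: mult.commute)
    qed (use alpha assms L in auto)
    also have "\<dots> = (2 * \<alpha>) powr \<alpha> * a powr (\<alpha> * (\<alpha> - 1))"
      unfolding tl using alpha assms
      by (simp add: powr_divide powr_minus powr_powr mult.commute field_simps powr_mult)
    finally show "(l / t) powr (- \<alpha>) \<le> (2 * \<alpha>) powr \<alpha> * a powr (\<alpha> * (\<alpha> - 1))" .
  qed auto
  also have "\<dots> = 4 * (2 * \<alpha>) powr \<alpha> * K powr (1 - \<alpha>)"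
  proof -
    have "\<alpha> * (1 - \<alpha>) = - (\<alpha> * (\<alpha> - 1))" by (simp add: algebra_simps)
    moreover have "(K * a powr \<alpha>) powr (1 - \<alpha>) = K powr (1 - \<alpha>) * a powr (\<alpha> * (1 - \<alpha>))"
      using assms(1,3) by (simp only: powr_mult powr_powr)
    ultimately have "(K * a powr \<alpha>) powr (1 - \<alpha>) = K powr (1 - \<alpha>) / a powr (\<alpha> * (\<alpha> - 1))"
      by (simp only: powr_minus divide_inverse)
    then show ?thesis using assms(1) by (simp only:) simp
  qed
  also have "\<dots> \<le> 4 * (2 * \<alpha>) powr \<alpha> * K powr (- 1)"
    using assms(3) alpha by (intro mult_left_mono powr_mono) auto
  also have "\<dots> = 4 * (2 * \<alpha>) powr \<alpha> / K"
    using assms(3) by (simp add: powr_minus divide_inverse)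
  finally show ?thesis .
qed

text \<open>With \<open>r = a powr \<alpha>\<close>, at most \<open>2 * K * r\<close> sites compete,
  each with probability at most \<open>K' powr (- \<alpha>) / r\<close>.\<close>

lemma prob_high_peak_le:
  assumes "0 < a" "1 \<le> K" "1 \<le> K'" "1 \<le> a powr \<alpha>"
  shows "prob (\<Union>y\<in>{..nat \<lfloor>K * a powr \<alpha>\<rfloor>}. {\<omega> \<in> space M. K' * a < xi0 (int y) \<omega>}) \<le> 2 * K / K'"
proof -
  define r where "r = a powr \<alpha>"
  have r: "1 \<le> r" "1 \<le> K * r" using assms mult_mono[of 1 K 1 r] by (auto simp: r_def)
  let ?N = "nat \<lfloor>K * r\<rfloor>"
  have N: "real ?N + 1 \<le> 2 * K * r"
  proof -
    have "real ?N \<le> K * r" using r by linarith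
    then show ?thesis using r by linarith
  qed
  have "prob (\<Union>y\<in>{..?N}. {\<omega> \<in> space M. K' * a < xi0 (int y) \<omega>})
     \<le> (\<Sum>y\<in>{..?N}. prob {\<omega> \<in> space M. K' * a < xi0 (int y) \<omega>})"
    by (intro measure_UNION_le) auto
  also have "\<dots> \<le> (\<Sum>y\<in>{..?N}. (K' * a) powr (- \<alpha>))"
    using assms by (intro sum_mono prob_xi0_gt_le) auto
  also have "\<dots> = (real ?N + 1) * (K' * a) powr (- \<alpha>)" by simp
  also have "\<dots> \<le> 2 * K * r * (K' * a) powr (- \<alpha>)" using N by (intro mult_right_mono) auto
  also have "\<dots> = 2 * K * K' powr (- \<alpha>)"
    using assms by (simp add: r_def powr_mult powr_minus field_simps)
  also have "\<dots> \<le> 2 * K * K' powr (- 1)"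
    using assms alpha by (intro mult_left_mono powr_mono) auto
  also have "\<dots> = 2 * K / K'" using assms by (simp add: powr_minus divide_inverse)
  finally show ?thesis unfolding r_def .
qed

text \<open>There are at most \<open>4 * K\<^sup>2 * r\<^sup>2\<close> pairs, and each contributes a
  multiple of \<open>\<delta> * a * a powr (- 2 * \<alpha> - 1) = \<delta> / r\<^sup>2\<close>. The
  total is thus small with \<open>\<delta>\<close>, uniformly in \<open>a\<close>.\<close>

lemma prob_close_pairs_le:
  fixes h K \<delta> a :: real and b :: "nat \<Rightarrow> nat \<Rightarrow> real"
  assumes "0 < h" "1 \<le> h * a" "1 \<le> K" "0 < \<delta>" "1 \<le> a powr \<alpha>"
  shows "prob (\<Union>(y, y')\<in>{(y, y'). y \<le> nat \<lfloor>K * a powr \<alpha>\<rfloor> \<and> y' \<le> nat \<lfloor>K * a powr \<alpha>\<rfloor> \<and> y \<noteq> y'}.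
            {\<omega> \<in> space M. h * a < xi0 (int y) \<omega> \<and> h * a < xi0 (int y') \<omega> \<and>
               \<bar>xi0 (int y) \<omega> - xi0 (int y') \<omega> - b y y'\<bar> \<le> \<delta> * a})
           \<le> 12 * K\<^sup>2 * \<alpha> * h powr (- 2 * \<alpha> - 1) * \<delta>" (is "prob (\<Union>(y, y')\<in>?S. ?E y y') \<le> _")
proof -
  have a0: "0 < a" using assms by (metis less_le_trans zero_less_mult_pos zero_less_one)
  define r where "r = a powr \<alpha>"
  have r: "1 \<le> r" "1 \<le> K * r" using assms mult_mono[of 1 K 1 r] by (auto simp: r_def)
  let ?N = "nat \<lfloor>K * r\<rfloor>"
  have sub: "?S \<subseteq> {..?N} \<times> {..?N}" by (auto simp: r_def)
  then have fin: "finite ?S" by (rule finite_subset) auto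
  have "real (card ?S) \<le> real (card ({..?N} \<times> {..?N}))"
    using sub by (intro of_nat_mono card_mono) auto
  also have "\<dots> = (real ?N + 1)\<^sup>2" by (simp add: power2_eq_square algebra_simps)
  also have "\<dots> \<le> (2 * K * r)\<^sup>2"
  proof (rule power_mono)
    have "real ?N \<le> K * r" using r by linarith
    then show "real ?N + 1 \<le> 2 * K * r" using r by linarith
  qed auto
  finally have card: "real (card ?S) \<le> 4 * K\<^sup>2 * r\<^sup>2" by (simp add: power_mult_distrib)
  let ?q = "3 * (\<delta> * a) * \<alpha> * (h * a) powr (- \<alpha> - 1) * (h * a) powr (- \<alpha>)"
  have "prob (\<Union>(y, y')\<in>?S. ?E y y') \<le> (\<Sum>z\<in>?S. prob (case z of (y, y') \<Rightarrow> ?E y y'))"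
    by (intro measure_UNION_le fin) (auto split: prod.split)
  also have "\<dots> \<le> (\<Sum>z\<in>?S. ?q)"
  proof (rule sum_mono)
    fix z assume "z \<in> ?S"
    then show "prob (case z of (y, y') \<Rightarrow> ?E y y') \<le> ?q"
      using assms a0 by (cases z) (auto intro!: prob_close_pair_le)
  qed
  also have "\<dots> = real (card ?S) * ?q" by simp
  also have "\<dots> \<le> 4 * K\<^sup>2 * r\<^sup>2 * ?q"
    using card assms a0 alpha by (intro mult_right_mono) auto
  also have "\<dots> = 12 * K\<^sup>2 * \<alpha> * \<delta> * (r\<^sup>2 * a * ((h * a) powr (- \<alpha> - 1) * (h * a) powr (- \<alpha>)))"
    by (simp add: algebra_simps)
  also have "(h * a) powr (- \<alpha> - 1) * (h * a) powr (- \<alpha>) = h powr (- 2 * \<alpha> - 1) * a powr (- 2 * \<alpha> - 1)"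
  proof -
    have "- \<alpha> - 1 + - \<alpha> = - 2 * \<alpha> - 1" by simp
    then have "(h * a) powr (- \<alpha> - 1) * (h * a) powr (- \<alpha>) = (h * a) powr (- 2 * \<alpha> - 1)"
      by (simp only: powr_add[symmetric])
    then show ?thesis using assms a0 by (simp only: powr_mult)
  qed
  also have "r\<^sup>2 * a * (h powr (- 2 * \<alpha> - 1) * a powr (- 2 * \<alpha> - 1)) = h powr (- 2 * \<alpha> - 1)"
  proof -
    have "a powr (2 * \<alpha> + 1) = r\<^sup>2 * a"
      using a0 by (simp only: r_def power2_eq_square powr_add mult_2 powr_one less_imp_le)
    moreover have "a powr (- 2 * \<alpha> - 1) = inverse (a powr (2 * \<alpha> + 1))"
      unfolding powr_minus[symmetric] by (rule arg_cong) simp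
    moreover have "r\<^sup>2 * a \<noteq> 0" using a0 r by simp
    ultimately show ?thesis by (metis mult.left_commute mult_1_right right_inverse)
  qed
  finally show ?thesis by (simp only: ac_simps)
qed

text \<open>The coin at \<open>y\<close> is independent of each of the two values; the factor
  \<open>2\<close> counts the sides.\<close>

lemma prob_exclusive_peak_le:
  assumes "0 < x"
  shows "(\<Union>y\<in>{1..N}. {\<omega> \<in> space M. C y \<omega> \<noteq> 1 \<and> (x < xi0 (int y) \<omega> \<or> x < xi0 (- int y) \<omega>)}) \<in> events"
    and "prob (\<Union>y\<in>{1..N}. {\<omega> \<in> space M. C y \<omega> \<noteq> 1 \<and> (x < xi0 (int y) \<omega> \<or> x < xi0 (- int y) \<omega>)})
           \<le> 2 * x powr (- \<alpha>) * (\<Sum>y\<in>{1..N}. 1 - p y)"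
proof -
  let ?F = "\<lambda>y. {\<omega> \<in> space M. C y \<omega> \<noteq> 1 \<and> (x < xi0 (int y) \<omega> \<or> x < xi0 (- int y) \<omega>)}"
  let ?G = "\<lambda>y z. {\<omega> \<in> space M. C y \<omega> \<noteq> 1 \<and> x < xi0 z \<omega>}"
  have G: "?G y z \<in> events" if "1 \<le> y" for y z
  proof -
    note [measurable] = C_measurable[OF that]
    show ?thesis by measurable
  qed
  have F_eq: "?F y = ?G y (int y) \<union> ?G y (- int y)" for y by auto
  have F: "?F y \<in> events" if "1 \<le> y" for y
    unfolding F_eq using G[OF that] by auto
  show "(\<Union>y\<in>{1..N}. ?F y) \<in> events" using F by auto
  have pG: "prob (?G y z) \<le> (1 - p y) * x powr (- \<alpha>)" if y: "1 \<le> y" for y z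
  proof -
    note [measurable] = C_measurable[OF that]
    have "?G y z = (\<lambda>\<omega>. (C y \<omega>, xi0 z \<omega>)) -` ((- {1}) \<times> {x<..}) \<inter> space M" by auto
    then have "prob (?G y z) = prob (C y -` (- {1}) \<inter> space M) * prob (xi0 z -` {x<..} \<inter> space M)"
      using indep_varD[OF indep_var_C_xi0[OF y], of "- {1}" "{x<..}" z] by simp
    also have "C y -` (- {1}) \<inter> space M = space M - {\<omega> \<in> space M. C y \<omega> = 1}" by auto
    also have "prob \<dots> = 1 - p y" using y by (subst prob_compl) (auto simp: copy)
    also have "xi0 z -` {x<..} \<inter> space M = {\<omega> \<in> space M. x < xi0 z \<omega>}" by auto
    also have "(1 - p y) * prob \<dots> \<le> (1 - p y) * x powr (- \<alpha>)"
    proof (rule mult_left_mono[OF prob_xi0_gt_le[OF assms]])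
      show "0 \<le> 1 - p y" using prob_le_1[of "{\<omega> \<in> space M. C y \<omega> = 1}"] unfolding copy[OF y] by linarith
    qed
    finally show ?thesis .
  qed
  have "prob (\<Union>y\<in>{1..N}. ?F y) \<le> (\<Sum>y\<in>{1..N}. prob (?F y))"
    by (intro measure_UNION_le F) auto
  also have "\<dots> \<le> (\<Sum>y\<in>{1..N}. (1 - p y) * x powr (- \<alpha>) + (1 - p y) * x powr (- \<alpha>))"
    unfolding F_eq using G
    by (intro sum_mono order_trans[OF measure_Un_le] add_mono pG) auto
  also have "\<dots> = 2 * x powr (- \<alpha>) * (\<Sum>y\<in>{1..N}. 1 - p y)"
    unfolding sum_distrib_left by (intro sum.cong) (simp_all add: algebra_simps)
  finally show "prob (\<Union>y\<in>{1..N}. ?F y) \<le> 2 * x powr (- \<alpha>) * (\<Sum>y\<in>{1..N}. 1 - p y)" .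
qed

text \<open>A Cesaro argument: the terms before \<open>n0\<close> contribute at most
  \<open>n0\<close>, the others at most \<open>e / (2 * K)\<close> each over at most
  \<open>K * r\<close> sites.\<close>

lemma eventually_exclusive_fraction_le:
  assumes "0 < e" "0 < K"
  shows "eventually (\<lambda>r. (\<Sum>y\<in>{1..nat \<lfloor>K * r\<rfloor>}. 1 - p y) \<le> e * r) at_top"
proof -
  have "eventually (\<lambda>n. 1 - e / (2 * K) < p n) sequentially"
    using p_lim assms by (intro order_tendstoD(1)) auto
  then obtain n0 where n0: "\<And>n. n0 \<le> n \<Longrightarrow> 1 - e / (2 * K) < p n"
    unfolding eventually_sequentially by auto
  have "eventually (\<lambda>r. max 1 (2 * real n0 / e) \<le> r) at_top" by (rule eventually_ge_at_top)
  then show ?thesis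
  proof eventually_elim
    case (elim r)
    let ?N = "nat \<lfloor>K * r\<rfloor>"
    have N: "real ?N \<le> K * r" using elim assms by simp
    have "(\<Sum>y\<in>{1..?N}. 1 - p y) \<le> (\<Sum>y\<in>{1..?N}. (if y < n0 then 1 else 0) + e / (2 * K))"
    proof (rule sum_mono)
      fix y assume "y \<in> {1..?N}"
      then have "0 \<le> p y" using copy[of y] measure_nonneg by (metis atLeastAtMost_iff)
      moreover have "0 < e / (2 * K)" using assms by simp
      ultimately show "1 - p y \<le> (if y < n0 then 1 else 0) + e / (2 * K)"
        using n0[of y] by (cases "y < n0") auto
    qed
    also have "\<dots> = real (card ({1..?N} \<inter> {y. y < n0})) + real ?N * (e / (2 * K))"
      by (simp add: sum.distrib sum.If_cases)
    also have "\<dots> \<le> real n0 + (K * r) * (e / (2 * K))"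
    proof (rule add_mono)
      have "card ({1..?N} \<inter> {y. y < n0}) \<le> card {..<n0}" by (intro card_mono) auto
      then show "real (card ({1..?N} \<inter> {y. y < n0})) \<le> real n0" by simp
      show "real ?N * (e / (2 * K)) \<le> (K * r) * (e / (2 * K))"
        using N assms by (intro mult_right_mono) auto
    qed
    also have "\<dots> \<le> e * r / 2 + e * r / 2"
      using elim assms by (intro add_mono) (auto simp: field_simps)
    finally show ?case by simp
  qed
qed

end

section \<open>Localisation in probability\<close>

text \<open>The solution of \<open>a powr (\<alpha> - 1) = t / ln t\<close>. Equivalently, the cost
  \<open>r * ln t / t\<close> of distance \<open>r = a powr \<alpha>\<close> equals
  \<open>a\<close>, the order of the largest of \<open>r\<close> Pareto values.\<close>

definition peak_scale :: "real \<Rightarrow> real \<Rightarrow> real" where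
  "peak_scale \<alpha> t = (t / ln t) powr (1 / (\<alpha> - 1))"

lemma peak_scale_pos: "1 < t \<Longrightarrow> 0 < peak_scale \<alpha> t"
  by (simp add: peak_scale_def)

lemma peak_scale_powr:
  assumes "1 < \<alpha>" "1 < t"
  shows "peak_scale \<alpha> t powr \<alpha> = peak_scale \<alpha> t * t / ln t"
proof -
  have "peak_scale \<alpha> t powr (\<alpha> - 1) = t / ln t"
    using assms by (simp add: peak_scale_def powr_powr)
  moreover have "peak_scale \<alpha> t powr \<alpha> = peak_scale \<alpha> t powr (1 + (\<alpha> - 1))" by simp
  ultimately show ?thesis
    using peak_scale_pos[OF assms(2), of \<alpha>] unfolding powr_add by simp
qed

lemma ln_peak_scale: "1 < t \<Longrightarrow> ln (peak_scale \<alpha> t) = (ln t - ln (ln t)) / (\<alpha> - 1)"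
  by (simp add: peak_scale_def ln_powr ln_div)

lemma filterlim_powr_at_top:
  fixes b :: real
  assumes "0 < b"
  shows "filterlim (\<lambda>x::real. x powr b) at_top at_top"
  using assms by real_asymp

lemma filterlim_peak_scale:
  assumes "1 < \<alpha>"
  shows "filterlim (peak_scale \<alpha>) at_top at_top"
proof -
  have "filterlim (\<lambda>t::real. t / ln t) at_top at_top" by real_asymp
  moreover have "filterlim (\<lambda>x::real. x powr (1 / (\<alpha> - 1))) at_top at_top"
    using assms by (intro filterlim_powr_at_top) auto
  ultimately show ?thesis
    unfolding peak_scale_def[abs_def] by (rule filterlim_compose[rotated])
qed

context duplicated_pareto
begin

text \<open>The constants \<open>h\<close>, \<open>K\<close>, \<open>K'\<close>,
  \<open>\<delta>\<close> are fixed in this order, each bounding the probability of one of six bad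
  events by \<open>\<tau> / 6\<close>; large \<open>t\<close> makes the other two events
  rare.\<close>

lemma eventually_prob_not_localised_le:
  fixes Z :: "real \<Rightarrow> 'a \<Rightarrow> nat"
  assumes Z: "\<And>t. 0 < t \<Longrightarrow> AE \<omega> in M.
           (let xi = pam_potential (\<lambda>z. xi0 z \<omega>) (\<lambda>n. C n \<omega>) in
              Z t \<omega> \<in> pam_D xi \<and>
              (\<forall>z\<in>pam_D xi. pam_Psi xi t (int z) \<le> pam_Psi xi t (int (Z t \<omega>))))"
    and "0 < \<epsilon>" "0 < \<tau>"
  shows "eventually (\<lambda>t. prob {\<omega> \<in> space M.
            (let xi = pam_potential (\<lambda>z. xi0 z \<omega>) (\<lambda>n. C n \<omega>) in
              \<bar>(enn2real (pam_u xi t (int (Z t \<omega>))) + enn2real (pam_u xi t (- int (Z t \<omega>))))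
                 / enn2real (pam_U xi t) - 1\<bar> > \<epsilon>)} \<le> \<tau>) at_top"
proof -
  \<comment> \<open>Makes the leaked share \<open>2 / (\<eta> - 2)\<close> equal to
    \<open>\<epsilon> / 2\<close>.\<close>
  define \<eta> where "\<eta> = 2 + 4 / \<epsilon>"
  have \<eta>: "2 < \<eta>" "2 / (\<eta> - 2) = \<epsilon> / 2" using assms by (auto simp: \<eta>_def)
  define h where "h = min 1 (\<tau> / 24)"
  have h: "0 < h" "h \<le> 1" "4 * h \<le> \<tau> / 6" using assms by (auto simp: h_def)
  define K where "K = max 1 (24 * (2 * \<alpha>) powr \<alpha> / \<tau>)"
  have K: "1 \<le> K" "4 * (2 * \<alpha>) powr \<alpha> / K \<le> \<tau> / 6"
  proof -
    show "1 \<le> K" by (simp add: K_def)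
    have "24 * (2 * \<alpha>) powr \<alpha> / \<tau> \<le> K" by (simp add: K_def)
    then show "4 * (2 * \<alpha>) powr \<alpha> / K \<le> \<tau> / 6"
      using assms \<open>1 \<le> K\<close> by (simp add: field_simps)
  qed
  define K' where "K' = max 1 (12 * K / \<tau>)"
  have K': "1 \<le> K'" "2 * K / K' \<le> \<tau> / 6"
  proof -
    show "1 \<le> K'" by (simp add: K'_def)
    have "12 * K / \<tau> \<le> K'" by (simp add: K'_def)
    then show "2 * K / K' \<le> \<tau> / 6"
      using assms \<open>1 \<le> K'\<close> by (simp add: field_simps)
  qed
  define c where "c = 12 * K\<^sup>2 * \<alpha> * (h / 8) powr (- 2 * \<alpha> - 1)"
  have c0: "0 < c" using K h alpha by (simp add: c_def)
  define \<delta> where "\<delta> = min (h / 8) (\<tau> / (6 * c))"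
  have \<delta>: "0 < \<delta>" "\<delta> \<le> h / 8" "c * \<delta> \<le> \<tau> / 6"
  proof -
    show "0 < \<delta>" "\<delta> \<le> h / 8" using h assms c0 by (auto simp: \<delta>_def)
    have "\<delta> \<le> \<tau> / (6 * c)" by (simp add: \<delta>_def)
    then show "c * \<delta> \<le> \<tau> / 6" using c0 by (simp add: field_simps)
  qed
  define a where "a = peak_scale \<alpha>"
  \<comment> \<open>Chosen so that
    \<open>2 * (h / 8) powr (- \<alpha>) * e = \<tau> / 6\<close>.\<close>
  define e where "e = \<tau> / 12 * (h / 8) powr \<alpha>"
  have e0: "0 < e" using assms h by (simp add: e_def)
  have a_top: "filterlim a at_top at_top"
    unfolding a_def using alpha by (intro filterlim_peak_scale) auto
  have r_top: "filterlim (\<lambda>t. a t powr \<alpha>) at_top at_top"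
    using alpha by (intro filterlim_compose[OF filterlim_powr_at_top a_top]) auto
  have ev_frac: "eventually (\<lambda>t. (\<Sum>y\<in>{1..nat \<lfloor>K * a t powr \<alpha>\<rfloor>}. 1 - p y) \<le> e * a t powr \<alpha>) at_top"
    using eventually_compose_filterlim[OF eventually_exclusive_fraction_le[OF e0] r_top, of K] K by simp
  have ev_a: "eventually (\<lambda>t. max (8 / h) (2 * (\<eta> + 3) / \<delta>) \<le> a t) at_top"
    using a_top unfolding filterlim_at_top by blast
  have ev_r: "eventually (\<lambda>t. max (max 1 (4 / h)) (6 / \<tau> * (h / 8) powr (- \<alpha>)) \<le> a t powr \<alpha>) at_top"
    using r_top unfolding filterlim_at_top by blast
  \<comment> \<open>The errors proportional to \<open>a\<close> have a vanishing coefficient and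
    take half of \<open>\<delta>\<close>; the constant \<open>\<eta> + 3\<close> takes the other
    half.\<close>
  have "((\<lambda>t. (2 + K + K * (ln K' + ln (ln t))) / ln t) \<longlongrightarrow> 0) at_top" by real_asymp
  then have ev_gap: "eventually (\<lambda>t. (2 + K + K * (ln K' + ln (ln t))) / ln t < \<delta> / 2) at_top"
    using \<delta> by (intro order_tendstoD(2)) auto
  have ev_ln: "eventually (\<lambda>t::real. 4 * K / h \<le> ln t) at_top"
    using ln_at_top unfolding filterlim_at_top by blast
  have "((\<lambda>t::real. ln (ln t) / ln t) \<longlongrightarrow> 0) at_top" by real_asymp
  then have ev_lnln: "eventually (\<lambda>t::real. ln (ln t) / ln t < 1 / (2 * \<alpha>)) at_top"
    using alpha by (intro order_tendstoD(2)) auto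
  have "((\<lambda>t::real. exp (- t)) \<longlongrightarrow> 0) at_top" by real_asymp
  then have ev_exp: "eventually (\<lambda>t::real. exp (- t) < \<epsilon> / 2) at_top"
    using assms by (intro order_tendstoD(2)) auto
  show ?thesis
    using ev_frac ev_a ev_r ev_gap ev_ln ev_lnln ev_exp eventually_gt_at_top[of 1]
  proof eventually_elim
    case (elim t)
    define x where "x = a t"
    define r where "r = x powr \<alpha>"
    define l where "l = ln (x / ln t)"
    have t: "1 < t" "0 < t" using elim by auto
    have x0: "0 < x" using peak_scale_pos[OF t(1)] by (simp add: x_def a_def)
    have r_eq: "r = x * t / ln t"
      unfolding r_def x_def a_def using alpha t by (intro peak_scale_powr) auto
    have "4 \<le> 4 * K / h" using K h by (simp add: field_simps)
    then have L: "4 \<le> ln t" using elim by linarith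
    have exp_l: "exp l = x / ln t" using x0 L by (simp add: l_def)
    have ln_x: "ln x = (ln t - ln (ln t)) / (\<alpha> - 1)"
      unfolding x_def a_def using t by (rule_tac ln_peak_scale)
    have lnln0: "0 \<le> ln (ln t)" using L by simp
    have ln_x_le: "ln x \<le> ln t"
    proof -
      have "ln t * 1 \<le> ln t * (\<alpha> - 1)" using alpha L by (intro mult_left_mono) auto
      then have "ln t - ln (ln t) \<le> ln t * (\<alpha> - 1)" using lnln0 by linarith
      then show ?thesis unfolding ln_x using alpha by (simp add: divide_le_eq)
    qed
    \<comment> \<open>Here \<open>l = (ln t - \<alpha> * ln (ln t)) / (\<alpha> - 1)\<close>, and
      the double logarithm takes at most half of \<open>ln t\<close>.\<close>
    have l_ge: "ln t / (2 * \<alpha>) \<le> l"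
    proof -
      have "ln (ln t) * (2 * \<alpha>) < ln t"
        using elim(6) L alpha by (simp add: field_simps)
      then have "ln t / 2 \<le> ln t - \<alpha> * ln (ln t)" by (simp add: algebra_simps)
      then have "ln t / 2 / (\<alpha> - 1) \<le> (ln t - \<alpha> * ln (ln t)) / (\<alpha> - 1)"
        using alpha by (intro divide_right_mono) auto
      also have "\<dots> = l"
        unfolding l_def using x0 L alpha by (simp add: ln_div ln_x field_simps)
      finally have "ln t / 2 / (\<alpha> - 1) \<le> l" .
      moreover have "ln t / 2 / \<alpha> \<le> ln t / 2 / (\<alpha> - 1)"
        using L alpha by (intro divide_left_mono) auto
      ultimately show ?thesis by simp
    qed
    have "0 \<le> ln t / (2 * \<alpha>)" using L alpha by simp
    then have "1 \<le> exp l" using l_ge by simp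
    then have x_ge: "ln t \<le> x" unfolding exp_l using L by (simp add: le_divide_eq)
    have r1: "1 \<le> r" "4 / h \<le> r" "6 / \<tau> * (h / 8) powr (- \<alpha>) \<le> r"
      using elim unfolding r_def x_def by auto
    have x1: "1 \<le> h / 8 * x" "2 * (\<eta> + 3) / \<delta> \<le> x"
      using elim h unfolding x_def by (auto simp: field_simps)
    have gap: "\<eta> + 3 + (2 + K) * x / ln t + K * (ln K' + ln (ln t)) / ln t * x \<le> \<delta> * x"
    proof -
      have "(2 + K + K * (ln K' + ln (ln t))) / ln t * x \<le> \<delta> / 2 * x"
        using elim x0 by (intro mult_right_mono) auto
      moreover have "\<eta> + 3 \<le> \<delta> / 2 * x" using x1(2) \<delta> by (simp add: field_simps)
      moreover have "(2 + K) * x / ln t + K * (ln K' + ln (ln t)) / ln t * x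
          = (2 + K + K * (ln K' + ln (ln t))) / ln t * x"
        by (simp add: add_divide_distrib distrib_right)
      moreover have "\<delta> / 2 * x + \<delta> / 2 * x = \<delta> * x" by simp
      ultimately show ?thesis by linarith
    qed
    define N where "N = nat \<lfloor>K * r\<rfloor>"
    have N: "real y \<le> K * r \<Longrightarrow> y \<le> N" for y unfolding N_def by (rule le_nat_floor)
    \<comment> \<open>Outside \<open>B1\<close> to \<open>B6\<close> the conditions
      \<open>E1\<close> to \<open>E6\<close> of \<open>pam_localisation_of_good_field\<close>
      hold.\<close>
    define B1 where "B1 = {\<omega> \<in> space M. \<forall>y\<in>{1..nat \<lfloor>h / 2 * r\<rfloor>}. xi0 (int y) \<omega> \<le> h * x}"
    define B2 where "B2 = {\<omega> \<in> space M. \<exists>y. K * r < \<bar>real_of_int y\<bar> \<and> l / t * \<bar>real_of_int y\<bar> < xi0 y \<omega>}"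
    define B3 where "B3 = (\<Union>y\<in>{..N}. {\<omega> \<in> space M. K' * x < xi0 (int y) \<omega>})"
    define B4 where "B4 = (\<Union>(y, y')\<in>{(y, y'). y \<le> N \<and> y' \<le> N \<and> y \<noteq> y'}.
            {\<omega> \<in> space M. h / 8 * x < xi0 (int y) \<omega> \<and> h / 8 * x < xi0 (int y') \<omega> \<and>
               \<bar>xi0 (int y) \<omega> - xi0 (int y') \<omega> - (real y - real y') * l / t\<bar> \<le> \<delta> * x})"
    define B5 where "B5 = {\<omega> \<in> space M. h / 8 * x < xi0 0 \<omega>}"
    define B6 where "B6 = (\<Union>y\<in>{1..N}. {\<omega> \<in> space M. C y \<omega> \<noteq> 1 \<and>
            (h / 8 * x < xi0 (int y) \<omega> \<or> h / 8 * x < xi0 (- int y) \<omega>)})"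
    define B where "B = B1 \<union> B2 \<union> B3 \<union> B4 \<union> B5 \<union> B6"
    have ev: "B1 \<in> events" "B2 \<in> events" "B3 \<in> events" "B4 \<in> events" "B5 \<in> events" "B6 \<in> events"
    proof -
      show "B1 \<in> events" "B2 \<in> events" "B3 \<in> events" "B5 \<in> events"
        unfolding B1_def B2_def B3_def B5_def by measurable
      have "finite {(y, y'). y \<le> N \<and> y' \<le> N \<and> y \<noteq> y'}"
        by (rule finite_subset[of _ "{..N} \<times> {..N}"]) auto
      then show "B4 \<in> events" unfolding B4_def by (intro sets.finite_UN) auto
      show "B6 \<in> events" unfolding B6_def using h x0 by (intro prob_exclusive_peak_le) auto
    qed
    have p1: "prob B1 \<le> \<tau> / 6"
    proof -
      have "h / 8 * x \<le> h * x" using h x0 by simp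
      then have "1 \<le> h * x" using x1 by linarith
      then have "prob B1 \<le> 4 * h"
        unfolding B1_def r_def using h r1 by (intro prob_no_near_peak_le) (auto simp: r_def)
      then show ?thesis using h by linarith
    qed
    have p2: "prob B2 \<le> \<tau> / 6"
      unfolding B2_def r_def using x0 t K r1 r_eq l_ge
      by (intro order_trans[OF prob_far_peak_scaled_le]) (auto simp: r_def)
    have p3: "prob B3 \<le> \<tau> / 6"
      unfolding B3_def N_def r_def using x0 K K' r1
      by (intro order_trans[OF prob_high_peak_le]) (auto simp: r_def)
    have p4: "prob B4 \<le> \<tau> / 6"
    proof -
      have "prob B4 \<le> 12 * K\<^sup>2 * \<alpha> * (h / 8) powr (- 2 * \<alpha> - 1) * \<delta>"
        unfolding B4_def N_def r_def using x1 h K \<delta> r1 by (intro prob_close_pairs_le) (auto simp: r_def)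
      then show ?thesis using \<delta> unfolding c_def by linarith
    qed
    have hx: "(h / 8 * x) powr (- \<alpha>) = (h / 8) powr (- \<alpha>) / r"
      using h x0 unfolding r_def divide_inverse powr_minus[symmetric] by (subst powr_mult) auto
    have p5: "prob B5 \<le> \<tau> / 6"
    proof -
      have "prob B5 \<le> (h / 8 * x) powr (- \<alpha>)" unfolding B5_def using x1 by (intro prob_xi0_gt_le) auto
      also have "\<dots> \<le> \<tau> / 6" unfolding hx using r1 assms by (simp add: field_simps)
      finally show ?thesis .
    qed
    have p6: "prob B6 \<le> \<tau> / 6"
    proof -
      have "prob B6 \<le> 2 * (h / 8 * x) powr (- \<alpha>) * (\<Sum>y\<in>{1..N}. 1 - p y)"
        unfolding B6_def using x1 by (intro prob_exclusive_peak_le) auto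
      also have "\<dots> \<le> 2 * (h / 8 * x) powr (- \<alpha>) * (e * r)"
        using elim(1) unfolding N_def r_def x_def by (intro mult_left_mono) auto
      also have "\<dots> = \<tau> / 6 * ((h / 8) powr (- \<alpha>) * (h / 8) powr \<alpha>)"
        unfolding hx e_def using r1 by simp
      also have "(h / 8) powr (- \<alpha>) * (h / 8) powr \<alpha> = 1"
        using h by (simp add: powr_minus)
      finally show ?thesis by simp
    qed
    have "prob B \<le> prob B1 + prob B2 + prob B3 + prob B4 + prob B5 + prob B6"
      unfolding B_def using ev
      by (intro order_trans[OF measure_Un_le] add_mono order_refl sets.Un)
    then have pB: "prob B \<le> \<tau>" using p1 p2 p3 p4 p5 p6 by linarith
    let ?A = "{\<omega> \<in> space M.
            (let xi = pam_potential (\<lambda>z. xi0 z \<omega>) (\<lambda>n. C n \<omega>) in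
              \<bar>(enn2real (pam_u xi t (int (Z t \<omega>))) + enn2real (pam_u xi t (- int (Z t \<omega>))))
                 / enn2real (pam_U xi t) - 1\<bar> > \<epsilon>)}"
    \<comment> \<open>Nothing is claimed about the measurability of \<open>?A\<close>; a non-measurable set has measure \<open>0\<close>.\<close>
    have "AE \<omega> in M. \<omega> \<in> ?A \<longrightarrow> \<omega> \<in> B"
      using AE_xi0_ge_1 Z[OF t(2)] AE_space
    proof eventually_elim
      case (elim \<omega>)
      let ?xi = "pam_potential (\<lambda>z. xi0 z \<omega>) (\<lambda>n. C n \<omega>)"
      have "\<bar>(enn2real (pam_u ?xi t (int (Z t \<omega>))) + enn2real (pam_u ?xi t (- int (Z t \<omega>))))
                 / enn2real (pam_U ?xi t) - 1\<bar> \<le> 2 / (\<eta> - 2) + exp (- t)" if nB: "\<omega> \<notin> B"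
      proof (rule pam_localisation_of_good_field[where a = x and r = r and l = l and h = h and K = K
            and K' = K' and \<delta> = \<delta>])
        show "\<exists>y::nat. 1 \<le> y \<and> real y \<le> h / 2 * r \<and> h * x < xi0 (int y) \<omega>"
        proof -
          have "\<omega> \<notin> B1" using nB by (simp add: B_def)
          then obtain y where y: "y \<in> {1..nat \<lfloor>h / 2 * r\<rfloor>}" "h * x < xi0 (int y) \<omega>"
            unfolding B1_def using elim(3) by (auto simp: not_le)
          have "0 \<le> h / 2 * r" using h r1 by simp
          then have "real (nat \<lfloor>h / 2 * r\<rfloor>) \<le> h / 2 * r" by (rule of_nat_floor)
          moreover have "real y \<le> real (nat \<lfloor>h / 2 * r\<rfloor>)" using y(1) by (simp only: of_nat_le_iff atLeastAtMost_iff)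
          ultimately have "real y \<le> h / 2 * r" by linarith
          then show ?thesis using y by auto
        qed
        show "xi0 y \<omega> \<le> l / t * \<bar>real_of_int y\<bar>" if "K * r < \<bar>real_of_int y\<bar>" for y
        proof -
          have "\<omega> \<notin> B2" using nB by (simp add: B_def)
          then show ?thesis unfolding B2_def using elim(3) that by force
        qed
        show "xi0 (int y) \<omega> \<le> K' * x" if "real y \<le> K * r" for y :: nat
        proof -
          have "\<omega> \<notin> B3" using nB by (simp add: B_def)
          then show ?thesis unfolding B3_def using elim(3) N[OF that] by force
        qed
        show "\<delta> * x < \<bar>xi0 (int y) \<omega> - xi0 (int y') \<omega> - (real y - real y') * l / t\<bar>"
          if "real y \<le> K * r" "real y' \<le> K * r" "y \<noteq> y'"
            "h / 8 * x < xi0 (int y) \<omega>" "h / 8 * x < xi0 (int y') \<omega>" for y y' :: nat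
        proof (rule ccontr)
          assume "\<not> ?thesis"
          then have "\<omega> \<in> B4" unfolding B4_def using elim(3) N[OF that(1)] N[OF that(2)] that(3-)
            by (intro UN_I[of "(y, y')"]) auto
          then show False using nB by (simp add: B_def)
        qed
        show "xi0 0 \<omega> < h / 4 * x"
        proof -
          have "\<omega> \<notin> B5" using nB by (simp add: B_def)
          then have "xi0 0 \<omega> \<le> h / 8 * x" unfolding B5_def using elim(3) by auto
          then show ?thesis using x1 by linarith
        qed
        show "xi0 (int y) \<omega> \<le> h / 8 * x \<and> xi0 (- int y) \<omega> \<le> h / 8 * x"
          if "1 \<le> y" "real y \<le> K * r" "C y \<omega> \<noteq> 1" for y :: nat
        proof (rule ccontr)
          assume "\<not> ?thesis"
          then have "\<omega> \<in> B6" unfolding B6_def using elim(3) N[OF that(2)] that(1,3)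
            by (intro UN_I[of y]) auto
          then show False using nB by (simp add: B_def)
        qed
      qed (use h K K' \<delta> \<eta> t x0 x_ge ln_x_le r_eq exp_l gap elim \<open>4 * K / h \<le> ln t\<close> in \<open>auto simp: Let_def\<close>)
      moreover have "2 / (\<eta> - 2) + exp (- t) \<le> \<epsilon>"
        using \<eta> \<open>exp (- t) < \<epsilon> / 2\<close> by linarith
      ultimately show ?case by (fastforce simp: Let_def)
    qed
    moreover have "B \<in> events" unfolding B_def using ev by auto
    ultimately have "prob ?A \<le> prob B" by (rule finite_measure_mono_AE)
    then show ?case using pB by linarith
  qed
qed

end

theorem theorem1p1:
  fixes M :: "'a measure"
    and \<alpha> :: real
    and p :: "nat \<Rightarrow> real"
    and xi0 :: "int \<Rightarrow> 'a \<Rightarrow> real"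
    and C :: "nat \<Rightarrow> 'a \<Rightarrow> real"
    and Z :: "real \<Rightarrow> 'a \<Rightarrow> nat"
  assumes "prob_space M"
    and "\<alpha> \<ge> 2"
    and "\<forall>n. 0 \<le> p n \<and> p n \<le> 1"
    and "\<exists>N. \<forall>m n. N \<le> m \<longrightarrow> m \<le> n \<longrightarrow> p m \<le> p n"
    and "p \<longlonglongrightarrow> 1"
    and "prob_space.indep_vars M (\<lambda>_. borel)
           (\<lambda>i. case i of Inl z \<Rightarrow> xi0 z | Inr n \<Rightarrow> C n)
           (range Inl \<union> Inr ` {1..})"
    and "\<forall>z x. x \<ge> 1 \<longrightarrow> measure M {\<omega> \<in> space M. xi0 z \<omega> > x} = x powr (- \<alpha>)"
    and "\<forall>n\<ge>1. measure M {\<omega> \<in> space M. C n \<omega> = 1} = p n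
              \<and> measure M {\<omega> \<in> space M. C n \<omega> = 0} = 1 - p n"
    and "\<forall>t. Z t \<in> measurable M (count_space UNIV)"
    and "\<forall>t>0. AE \<omega> in M.
           (let xi = pam_potential (\<lambda>z. xi0 z \<omega>) (\<lambda>n. C n \<omega>) in
              Z t \<omega> \<in> pam_D xi \<and>
              (\<forall>z\<in>pam_D xi. pam_Psi xi t (int z) \<le> pam_Psi xi t (int (Z t \<omega>))))"
  shows "\<forall>\<epsilon>>0. ((\<lambda>t. measure M {\<omega> \<in> space M.
            (let xi = pam_potential (\<lambda>z. xi0 z \<omega>) (\<lambda>n. C n \<omega>) in
              \<bar>(enn2real (pam_u xi t (int (Z t \<omega>))) + enn2real (pam_u xi t (- int (Z t \<omega>))))
                 / enn2real (pam_U xi t) - 1\<bar> > \<epsilon>)}) \<longlongrightarrow> 0) at_top"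
proof -
  interpret prob_space M by fact
  interpret duplicated_pareto M \<alpha> p xi0 C
    by unfold_locales (use assms in auto)
  have ev: "eventually (\<lambda>t. prob {\<omega> \<in> space M.
            (let xi = pam_potential (\<lambda>z. xi0 z \<omega>) (\<lambda>n. C n \<omega>) in
              \<bar>(enn2real (pam_u xi t (int (Z t \<omega>))) + enn2real (pam_u xi t (- int (Z t \<omega>))))
                 / enn2real (pam_U xi t) - 1\<bar> > \<epsilon>)} < \<tau>) at_top"
    if "0 < \<epsilon>" "0 < \<tau>" for \<epsilon> \<tau> :: real
  proof -
    \<comment> \<open>Halving \<open>\<tau>\<close> turns the weak bound into the strict
      one.\<close>
    have "0 < \<tau> / 2" using that by simp
    have "eventually (\<lambda>t. prob {\<omega> \<in> space M.
            (let xi = pam_potential (\<lambda>z. xi0 z \<omega>) (\<lambda>n. C n \<omega>) in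
              \<bar>(enn2real (pam_u xi t (int (Z t \<omega>))) + enn2real (pam_u xi t (- int (Z t \<omega>))))
                 / enn2real (pam_U xi t) - 1\<bar> > \<epsilon>)} \<le> \<tau> / 2) at_top"
      by (rule eventually_prob_not_localised_le) (use assms(10) that in auto)
    then show ?thesis by (rule eventually_mono) (use that in linarith)
  qed
  show ?thesis
  proof (intro allI impI)
    fix \<epsilon> :: real
    assume "0 < \<epsilon>"
    then show "((\<lambda>t. prob {\<omega> \<in> space M.
            (let xi = pam_potential (\<lambda>z. xi0 z \<omega>) (\<lambda>n. C n \<omega>) in
              \<bar>(enn2real (pam_u xi t (int (Z t \<omega>))) + enn2real (pam_u xi t (- int (Z t \<omega>))))
                 / enn2real (pam_U xi t) - 1\<bar> > \<epsilon>)}) \<longlongrightarrow> 0) at_top"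
      by (intro order_tendstoI ev) (auto intro!: always_eventually less_le_trans[OF _ measure_nonneg])
  qed
qed

end
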